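(* Let $r\in\mathbb N$ and let $k_2$ be an integer with $0<k_2<r-2$ (so $r\ge4$). Let $x\in L^r_{\infty,\infty}(\mathbb R)$, and let $a,b,\lambda>0$ be numbers such that the function $\Psi_{a,b,\lambda}(t)=b\,\psi_r(a;\lambda t)$ satisfies $$\|x^{(s)}\|\le\|\Psi^{(s)}_{a,b,\lambda}\|,\qquad s\in\{0,\,r-2,\,r\}.$$ Then $$\|x^{(k_2)}\|\le\|\Psi^{(k_2)}_{a,b,\lambda}\|.$$
   Context: Throughout, $\|\cdot\|$ is the norm of $L_\infty(\mathbb R)$ (essential supremum of the absolute value over $\mathbb R$). For $r\in\mathbb N$, $L^r_\infty(\mathbb R)$ is the space of functions $x:\mathbb R\to\mathbb R$ such that $x^{(r-1)}$ (with $x^{(0)}=x$) exists and is locally absolutely continuous and $x^{(r)}\in L_\infty(\mathbb R)$; $L^r_{\infty,\infty}(\mathbb R):=L^r_\infty(\mathbb R)\cap L_\infty(\mathbb R)$. Comparison splines: for $a\geq 0$ define $\psi_1(a;t)$ on $[0,a+2]$ by $\psi_1(a;t)=t-1$ for $t\in[0,1]$, $\psi_1(a;t)=0$ for $t\in[1,a+1]$, $\psi_1(a;t)=t-a-1$ for $t\in[a+1,a+2]$; extend it evenly to $[-(a+2),0]$ and then periodically with period $4+2a$ to $\mathbb R$. For $r\in\mathbb N$, $\psi_r(a;\cdot)$ is the $(r-1)$-th $(4+2a)$-periodic integral of $\psi_1(a;\cdot)$ with zero mean value over the period (so $\psi_r'(a;t)=\psi_{r-1}(a;t)$ for $r\ge2$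 and each $\psi_r(a;\cdot)$ is $(4+2a)$-periodic with zero mean). For parameters $a,b,\lambda$ put $\Psi_{a,b,\lambda}(t):=b\,\psi_r(a;\lambda t)$. *)

theory Defs
  imports "HOL-Probability.Essential_Supremum"
begin

text \<open>
  The norm of \<open>L\<^sub>\<infinity>(\<real>)\<close>, with value \<open>\<infinity>\<close> outside of that space; in particular for functions
  that are not Lebesgue measurable, by the convention built into \<^const>\<open>esssup\<close>.
\<close>

definition Linf_norm :: "(real \<Rightarrow> real) \<Rightarrow> ereal" where
  "Linf_norm f = esssup lebesgue (\<lambda>t. ereal \<bar>f t\<bar>)"

definition Linf :: "(real \<Rightarrow> real) set" where
  "Linf = {f \<in> borel_measurable lebesgue. Linf_norm f < \<infinity>}"

definition abs_continuous_on_interval :: "real \<Rightarrow> real \<Rightarrow> (real \<Rightarrow> real) \<Rightarrow> bool" where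
  "abs_continuous_on_interval c d f \<longleftrightarrow>
     (\<forall>\<epsilon>>0. \<exists>\<delta>>0. \<forall>n::nat. \<forall>u v :: nat \<Rightarrow> real.
        (\<forall>i<n. c \<le> u i \<and> u i \<le> v i \<and> v i \<le> d) \<longrightarrow>
        disjoint_family_on (\<lambda>i. {u i<..<v i}) {..<n} \<longrightarrow>
        (\<Sum>i<n. v i - u i) < \<delta> \<longrightarrow>
        (\<Sum>i<n. \<bar>f (v i) - f (u i)\<bar>) < \<epsilon>)"

definition locally_abs_continuous :: "(real \<Rightarrow> real) \<Rightarrow> bool" where
  "locally_abs_continuous f \<longleftrightarrow> (\<forall>c d. c \<le> d \<longrightarrow> abs_continuous_on_interval c d f)"

text \<open>
  The \<open>k\<close>-th derivative is \<open>(deriv ^^ k) x\<close>. For \<open>x\<close> in the space \<open>L\<^sup>r\<^sub>\<infinity>(\<real>)\<close> below, all derivatives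
  of order less than \<open>r\<close> exist everywhere, whereas that of order \<open>r\<close> is only guaranteed to exist
  almost everywhere. On the remaining null set \<^const>\<open>deriv\<close> has an unspecified value, which
  affects neither measurability nor the essential supremum, as \<^const>\<open>lebesgue\<close> is complete.
\<close>

definition Lr_inf :: "nat \<Rightarrow> (real \<Rightarrow> real) set" where
  "Lr_inf r = {x.
     (\<forall>k < r - 1. \<forall>t. (deriv ^^ k) x differentiable (at t)) \<and>
     locally_abs_continuous ((deriv ^^ (r - 1)) x) \<and>
     (deriv ^^ r) x \<in> Linf}"

definition Lr_inf_inf :: "nat \<Rightarrow> (real \<Rightarrow> real) set" where
  "Lr_inf_inf r = Lr_inf r \<inter> Linf"

definition psi1_base :: "real \<Rightarrow> real \<Rightarrow> real" where
  "psi1_base a t = (if t \<le> 1 then t - 1 else if t \<le> a + 1 then 0 else t - a - 1)"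

text \<open>
  The number \<open>t - T * round (t / T)\<close> is the representative of \<open>t\<close> modulo \<open>T\<close> in \<open>[-T/2, T/2)\<close>, here
  with \<open>T/2 = a + 2\<close>; the absolute value performs the even extension.
\<close>

definition psi1 :: "real \<Rightarrow> real \<Rightarrow> real" where
  "psi1 a t = psi1_base a \<bar>t - (4 + 2 * a) * of_int (round (t / (4 + 2 * a)))\<bar>"

text \<open>
  The antiderivative with zero mean over a period \<open>T\<close>; it is again \<open>T\<close>-periodic
  if \<open>f\<close> is \<open>T\<close>-periodic with zero mean, see the lemmas below.
\<close>

definition zero_mean_integral :: "real \<Rightarrow> (real \<Rightarrow> real) \<Rightarrow> real \<Rightarrow> real" where
  "zero_mean_integral T f t =
     (LBINT u=0..t. f u) - (LBINT s=0..T. (LBINT u=0..s. f u)) / T"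

definition psi :: "nat \<Rightarrow> real \<Rightarrow> real \<Rightarrow> real" where
  "psi r a = (zero_mean_integral (4 + 2 * a) ^^ (r - 1)) (psi1 a)"

definition Psi :: "nat \<Rightarrow> real \<Rightarrow> real \<Rightarrow> real \<Rightarrow> real \<Rightarrow> real" where
  "Psi r a b l t = b * psi r a (l * t)"

lemma psi1_fundamental:
  assumes "a \<ge> 0" "\<bar>t\<bar> \<le> a + 2"
  shows "psi1 a t = psi1_base a \<bar>t\<bar>"
proof (cases "t = a + 2")
  case True
  then have "t / (4 + 2 * a) = 1 / 2"
    using assms by (simp add: field_simps)
  then have "round (t / (4 + 2 * a)) = 1"
    by (simp add: round_def)
  then show ?thesis
    using True assms by (simp add: psi1_def)
next
  case False
  then have "round (t / (4 + 2 * a)) = 0"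
    using assms by (auto simp: round_def floor_eq_iff field_simps abs_le_iff)
  then show ?thesis
    by (simp add: psi1_def)
qed

lemma psi1_periodic:
  assumes "a \<ge> 0"
  shows "psi1 a (t + (4 + 2 * a)) = psi1 a t"
proof -
  have "(t + (4 + 2 * a)) / (4 + 2 * a) = t / (4 + 2 * a) + 1"
    using assms by (simp add: add_divide_distrib)
  then have "round ((t + (4 + 2 * a)) / (4 + 2 * a)) = round (t / (4 + 2 * a)) + 1"
    unfolding round_def by linarith
  then show ?thesis
    by (simp add: psi1_def algebra_simps)
qed

lemma zero_mean_integral_deriv:
  assumes "continuous_on UNIV f"
  shows "(zero_mean_integral T f has_real_derivative f t) (at t)"
proof -
  let ?a = "min 0 t - 1" and ?b = "max 0 t + 1"
  have "((\<lambda>u. LBINT y=0..u. f y) has_vector_derivative f t) (at t within {?a..?b})"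
    using interval_integral_FTC2[of ?a 0 ?b f t] continuous_on_subset[OF assms]
    by (auto simp: zero_ereal_def)
  then have "((\<lambda>u. LBINT y=0..u. f y) has_vector_derivative f t) (at t)"
    by (subst (asm) at_within_interior) (auto simp: min_def max_def)
  then show ?thesis
    unfolding zero_mean_integral_def
    by (auto intro!: derivative_eq_intros simp: has_real_derivative_iff_has_vector_derivative)
qed

lemma zero_mean_integral_continuous:
  assumes "continuous_on UNIV f"
  shows "continuous_on UNIV (zero_mean_integral T f)"
  using zero_mean_integral_deriv[OF assms]
  by (meson DERIV_isCont continuous_at_imp_continuous_on)

lemma zero_mean_integral_mean:
  assumes "continuous_on UNIV f" "T > 0"
  shows "(LBINT t=0..T. zero_mean_integral T f t) = 0"
proof -
  let ?F = "\<lambda>t. LBINT u=0..ereal t. f u"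
  have F: "?F = (\<lambda>t. zero_mean_integral T f t + (LBINT s=0..T. ?F s) / T)"
    by (simp add: zero_mean_integral_def)
  have "continuous_on UNIV ?F"
    by (subst F) (intro continuous_intros zero_mean_integral_continuous assms)
  then have "interval_lebesgue_integrable lborel 0 (ereal T) ?F"
    unfolding zero_ereal_def
    by (intro interval_integrable_continuous_on) (use assms in \<open>auto intro: continuous_on_subset\<close>)
  then show ?thesis
    using assms by (simp add: zero_mean_integral_def zero_ereal_def)
qed

lemma zero_mean_integral_periodic:
  assumes "continuous_on UNIV f" "\<And>t. f (t + T) = f t" "(LBINT t=0..T. f t) = 0"
  shows "zero_mean_integral T f (t + T) = zero_mean_integral T f t"
proof -
  let ?g = "\<lambda>t. zero_mean_integral T f (t + T) - zero_mean_integral T f t"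
  have "(?g has_real_derivative 0) (at s)" for s
  proof -
    have "((\<lambda>s. zero_mean_integral T f (s + T)) has_real_derivative f s) (at s)"
      using zero_mean_integral_deriv[OF assms(1), of T "s + T"]
      by (simp add: DERIV_shift assms(2))
    from DERIV_diff[OF this zero_mean_integral_deriv[OF assms(1), of T s]]
    show ?thesis by simp
  qed
  then have "?g t = ?g 0"
    using DERIV_isconst_all[of ?g t 0] by blast
  also have "\<dots> = 0"
    using assms(3) by (simp add: zero_mean_integral_def flip: zero_ereal_def)
  finally show ?thesis by simp
qed

end

theory Submission
  imports Defs
begin

text \<open>
  The proof is a comparison argument in the style of Kolmogorov. With \<open>m = r - 1\<close>, scaling turns the
  derivatives of \<open>x\<close> into a chain \<open>G 0, ..., G m\<close> of functions, each the derivative of the next one,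
  with \<open>G m\<close> a multiple of \<open>x\<close>. They are compared with splines \<open>bump a 0, ..., bump a m\<close>, which are
  \<open>psi 1 a, ..., psi r a\<close> translated so that each has its peak at \<open>0\<close>. In these terms the three
  hypotheses say that \<open>G 0\<close> has Lipschitz constant \<open>1\<close> and that \<open>G 1\<close> and \<open>G m\<close> do not exceed the peaks
  of \<open>bump a 1\<close> and \<open>bump a m\<close> (predicate \<open>spline_class\<close>). The conclusion is the corresponding bound
  on a level in between.

  It suffices to go down one level (\<open>derivative_bound\<close>). Let \<open>f = G (n + 1)\<close> and \<open>g = G n\<close>, and suppose
  that \<open>g\<close> exceeded the peak of \<open>bump a n\<close>. Scale both functions so that the supremum of
  \<open>\<bar>g\<bar>\<close> falls just below this peak. Next to a point where \<open>g\<close> is almost as large as possible,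
  \<open>g\<close> descends no faster than \<open>bump a n\<close> does (\<open>slow_descent\<close>). Hence \<open>f\<close> grows there by almost as much
  as an antiderivative of \<open>bump a n\<close> grows over the positive half wave, which is twice the peak of
  \<open>bump a (n + 1)\<close>. But the scaled \<open>f\<close> oscillates less than that. This argument needs a spline whose
  maximum is strict. For \<open>a > 0\<close> the spline \<open>bump a 1\<close> has a flat top, and at this level the bound is
  the hypothesis on the derivative of order \<open>r - 2\<close>.

  That functions of the class descend slowly is shown by induction on the level. On level \<open>0\<close> it is the
  Lipschitz condition. For the step, let \<open>f\<close> take the same value as \<open>bump a (n + 1)\<close> at a point. Then \<open>f\<close>
  is not steeper there than the spline (\<open>comparison\<close>): otherwise \<open>f'\<close>, which descends slowly, would drive
  \<open>f\<close> past its bound. A function that is less steep wherever it meets the spline stays on one side of it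
  (\<open>nonneg_barrier\<close>). All this happens in classes with a factor \<open>\<mu> < 1\<close>, so that the
  inequalities are strict.

  One step is of a different nature. The bound on the derivative of order \<open>r\<close> is an essential one, and
  this derivative exists only almost everywhere. It becomes a Lipschitz condition by Lebesgue's theorem
  that a locally absolutely continuous function is differentiable almost everywhere
  (\<open>locally_abs_continuous_AE_differentiable\<close>). The proof is by Vitali coverings: on a set where
  difference quotients oscillate around two values \<open>p < q\<close>, one can choose finitely many disjoint
  intervals of slope below \<open>p\<close>, and inside them intervals of slope above \<open>q\<close>, such that both families
  nearly exhaust the set. What lies between the two families has small measure, so absolute continuity
  forces the two total increments to agree, which is impossible unless the set is null.
\<close>

section \<open>Comparison splines with the peak at zero\<close>

lemma abs_diff_multiple: "T > 0 \<Longrightarrow> \<bar>t - T * y\<bar> = T * \<bar>t / T - y\<bar>" for t T y :: real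
  by (simp add: abs_if field_simps)

text \<open>
  The sum \<open>?F (s + T / 2) + ?F s\<close> has derivative zero. Its constant value vanishes because integrating
  it over half a period gives the integral of \<open>?F\<close> over a full period.
\<close>

lemma zero_mean_integral_antiperiodic:
  assumes f: "continuous_on UNIV f" and T: "T > 0" and anti: "\<And>t. f (t + T / 2) = - f t"
  shows "zero_mean_integral T f (t + T / 2) = - zero_mean_integral T f t"
proof -
  let ?F = "zero_mean_integral T f"
  let ?H = "zero_mean_integral T ?F"
  have F: "(?F has_real_derivative f s) (at s)" for s
    by (rule zero_mean_integral_deriv[OF f])
  have H: "(?H has_real_derivative ?F s) (at s)" for s
    by (rule zero_mean_integral_deriv[OF zero_mean_integral_continuous[OF f]])
  define k where "k = ?F (T / 2) + ?F 0"
  have "((\<lambda>s. ?F (s + T / 2) + ?F s) has_real_derivative 0) (at s)" for s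
    using DERIV_add[OF DERIV_shift[THEN iffD1, OF F[of "s + T / 2"]] F[of s]] by (simp add: anti)
  then have k: "?F (s + T / 2) + ?F s = k" for s
    using DERIV_isconst_all[of "\<lambda>s. ?F (s + T / 2) + ?F s" s 0] by (simp add: k_def)
  have "((\<lambda>s. ?H (s + T / 2) + ?H s - k * s) has_real_derivative ?F (s + T / 2) + ?F s - k) (at s)" for s
    using DERIV_shift[THEN iffD1, OF H[of "s + T / 2"]] H[of s]
    by (auto intro!: derivative_eq_intros)
  then have "((\<lambda>s. ?H (s + T / 2) + ?H s - k * s) has_real_derivative 0) (at s)" for s
    by (simp add: k)
  then have "?H (T / 2 + T / 2) + ?H (T / 2) - k * (T / 2) = ?H (0 + T / 2) + ?H 0 - k * 0"
    by (rule DERIV_isconst_all[rule_format])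
  moreover have "?H T = ?H 0"
    using zero_mean_integral_mean[OF f T]
    by (simp add: zero_mean_integral_def[of T "?F"] flip: zero_ereal_def)
  ultimately have "k = 0"
    using T by simp
  then show ?thesis using k[of t] by simp
qed

lemma psi_Suc_Suc: "psi (Suc (Suc n)) a = zero_mean_integral (4 + 2 * a) (psi (Suc n) a)"
  by (simp add: psi_def)

context
  fixes a :: real
  assumes a: "a \<ge> 0"
begin

lemma psi1_period_int: "psi1 a (t + (4 + 2 * a) * of_int k) = psi1 a t"
proof -
  have "(t + (4 + 2 * a) * of_int k) / (4 + 2 * a) = t / (4 + 2 * a) + of_int k"
    using a by (simp add: add_divide_distrib)
  then have "round ((t + (4 + 2 * a) * of_int k) / (4 + 2 * a)) = round (t / (4 + 2 * a)) + k"
    unfolding round_def by linarith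
  then show ?thesis
    by (simp add: psi1_def algebra_simps)
qed

text \<open>
  The even extension makes \<open>psi1\<close> a function of the distance to the nearest multiple of the period, so
  that its properties can be checked on one period centred at \<open>0\<close>.
\<close>

lemma psi1_representative:
  obtains s k where "\<bar>s\<bar> \<le> a + 2" "t = s + (4 + 2 * a) * of_int k"
proof
  let ?T = "4 + 2 * a"
  let ?k = "round (t / ?T)"
  show "t = (t - ?T * of_int ?k) + ?T * of_int ?k" by simp
  have "\<bar>t - ?T * of_int ?k\<bar> = ?T * \<bar>of_int ?k - t / ?T\<bar>"
    using abs_diff_multiple[of ?T t "of_int ?k"] a by (simp add: abs_minus_commute)
  also have "\<dots> \<le> ?T * (1 / 2)"
    using of_int_round_abs_le[of "t / ?T"] a by (intro mult_left_mono) auto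
  finally show "\<bar>t - ?T * of_int ?k\<bar> \<le> a + 2" by simp
qed

lemma psi1_even: "psi1 a (- t) = psi1 a t"
proof -
  obtain s k where s: "\<bar>s\<bar> \<le> a + 2" "t = s + (4 + 2 * a) * of_int k"
    by (rule psi1_representative)
  then have "psi1 a (- t) = psi1 a (- s)"
    using psi1_period_int[of "- s" "- k"] by (simp add: algebra_simps)
  then show ?thesis
    using s psi1_fundamental[OF a] by (simp add: psi1_period_int)
qed

lemma psi1_antiperiodic: "psi1 a (t + (a + 2)) = - psi1 a t"
proof -
  obtain s k where s: "\<bar>s\<bar> \<le> a + 2" "t = s + (4 + 2 * a) * of_int k"
    by (rule psi1_representative)
  have refl: "psi1_base a (a + 2 - \<bar>s\<bar>) = - psi1_base a \<bar>s\<bar>"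
    using a s(1) by (auto simp: psi1_base_def)
  have "psi1 a (t + (a + 2)) = psi1 a (s + (a + 2))"
    using psi1_period_int[of "s + (a + 2)" k] s(2) by (simp add: algebra_simps)
  also have "\<dots> = psi1_base a (a + 2 - \<bar>s\<bar>)"
  proof (cases "s \<le> 0")
    case True
    with s(1) have "\<bar>s + (a + 2)\<bar> = a + 2 - \<bar>s\<bar>" by linarith
    then show ?thesis using psi1_fundamental[OF a, of "s + (a + 2)"] by simp
  next
    case False
    then show ?thesis
      using s(1) psi1_fundamental[OF a, of "s - (a + 2)"] psi1_periodic[OF a, of "s - (a + 2)"]
      by (simp add: abs_if algebra_simps)
  qed
  also have "\<dots> = - psi1 a t"
    using s refl psi1_fundamental[OF a s(1)] by (simp add: psi1_period_int)
  finally show ?thesis .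
qed

text \<open>
  The distance to the set of multiples of the period is a Lipschitz function with constant \<open>1\<close>, and so is the
  profile \<open>psi1_base\<close>.
\<close>

lemma psi1_lipschitz: "\<bar>psi1 a s - psi1 a t\<bar> \<le> \<bar>s - t\<bar>"
proof -
  let ?T = "4 + 2 * a"
  define d where "d t = \<bar>t - ?T * of_int (round (t / ?T))\<bar>" for t
  have d_le: "d t \<le> \<bar>t - ?T * of_int k\<bar>" for t k
  proof -
    have "d t = ?T * \<bar>t / ?T - of_int (round (t / ?T))\<bar>"
      unfolding d_def using a by (intro abs_diff_multiple) simp
    also have "\<dots> \<le> ?T * \<bar>t / ?T - of_int k\<bar>"
      using round_diff_minimal[of "t / ?T" k] a by (intro mult_left_mono) auto
    also have "\<dots> = \<bar>t - ?T * of_int k\<bar>"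
      using a by (intro abs_diff_multiple[symmetric]) simp
    finally show ?thesis .
  qed
  have "d s \<le> d t + \<bar>s - t\<bar>" for s t
    using d_le[of s "round (t / ?T)"] unfolding d_def by linarith
  from this[of s t] this[of t s] have d: "\<bar>d s - d t\<bar> \<le> \<bar>s - t\<bar>"
    by (simp add: abs_minus_commute abs_le_iff)
  have "\<bar>psi1_base a u - psi1_base a v\<bar> \<le> \<bar>u - v\<bar>" for u v
    using a by (auto simp: psi1_base_def)
  with d show ?thesis
    by (metis d_def psi1_def order_trans)
qed

lemma psi_continuous: "continuous_on UNIV (psi (Suc n) a)"
proof (induction n)
  case 0
  have "(1::real)-lipschitz_on UNIV (psi1 a)"
    by (rule lipschitz_onI) (use psi1_lipschitz in \<open>auto simp: dist_real_def\<close>)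
  then show ?case
    using lipschitz_on_continuous_on by (auto simp: psi_def)
qed (simp add: psi_Suc_Suc zero_mean_integral_continuous)

lemma psi_deriv: "(psi (Suc (Suc n)) a has_real_derivative psi (Suc n) a t) (at t)"
  unfolding psi_Suc_Suc by (rule zero_mean_integral_deriv[OF psi_continuous])

lemma psi_antiperiodic: "psi (Suc n) a (t + (a + 2)) = - psi (Suc n) a t"
proof (induction n arbitrary: t)
  case 0
  then show ?case using psi1_antiperiodic by (simp add: psi_def)
next
  case (Suc n)
  have half: "(4 + 2 * a) / 2 = a + 2" by simp
  show ?case
    using zero_mean_integral_antiperiodic[OF psi_continuous, of "4 + 2 * a" n t] a Suc
    unfolding psi_Suc_Suc half by simp
qed

end

text \<open>
  The shift, a multiple of the quarter period \<open>a / 2 + 1\<close>, undoes the phase that each integration adds: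
  all bumps are even with their maximum at \<open>0\<close>, and the derivative of one is the previous one shifted by
  a quarter period.
\<close>

definition bump :: "real \<Rightarrow> nat \<Rightarrow> real \<Rightarrow> real" where
  "bump a n t = psi (Suc n) a (t + (real n - 2) * (a / 2 + 1))"

text \<open>
  The half-width of the central positive hump. On level \<open>0\<close> the hump is a triangle, followed by a stretch of
  zeros up to the quarter period. From level \<open>1\<close> on the hump fills the whole half period.
\<close>

definition foot :: "real \<Rightarrow> nat \<Rightarrow> real" where
  "foot a n = (if n = 0 then 1 else a / 2 + 1)"

context
  fixes a c :: real
  assumes a: "a \<ge> 0"
  defines "c \<equiv> a / 2 + 1"
begin

lemma c_ge_1: "c \<ge> 1"
  using a by (simp add: c_def)

lemma foot_bounds: "0 < foot a n" "foot a n \<le> c"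
  using a by (auto simp: foot_def c_def)

lemma bump_continuous: "continuous_on S (bump a n)"
  unfolding bump_def
  by (rule continuous_on_compose2[OF psi_continuous[OF a]]) (auto intro!: continuous_intros)

lemma bump_antiperiodic: "bump a n (t + 2 * c) = - bump a n t"
  using psi_antiperiodic[OF a, of n "t + (real n - 2) * c"]
  by (simp add: bump_def c_def algebra_simps)

text \<open>
  The shift is written as \<open>t - c\<close> instead of \<open>t + c\<close>, at the price of a sign, because for \<open>t\<close> in
  \<open>[0, 2 * c]\<close>, where the spline decreases, \<open>t - c\<close> then runs through the hump.
\<close>

lemma bump_deriv: "(bump a (Suc n) has_real_derivative - bump a n (t - c)) (at t)"
proof -
  have "bump a n (t + c) = - bump a n (t - c)"
    using bump_antiperiodic[of n "t - c"] by (simp add: algebra_simps)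
  moreover have "t + (real (Suc n) - 2) * c = (t + c) + (real n - 2) * c"
    by (simp add: algebra_simps)
  then have "(bump a (Suc n) has_real_derivative bump a n (t + c)) (at t)"
    using DERIV_shift[THEN iffD1, OF psi_deriv[OF a, of n "t + (real (Suc n) - 2) * c"]]
    unfolding bump_def[abs_def] c_def[symmetric] by (simp add: add.assoc)
  ultimately show ?thesis by simp
qed

lemma bump_0_eq_psi1: "bump a 0 t = psi1 a (t - (a + 2))"
proof -
  have "t + (real 0 - 2) * (a / 2 + 1) = t - (a + 2)" by (simp add: algebra_simps)
  then show ?thesis unfolding bump_def by (simp only: psi_def) simp
qed

lemma bump_even: "bump a n (- t) = bump a n t"
proof (induction n arbitrary: t)
  case 0
  have "psi1 a (- t - (a + 2)) = psi1 a (t + (a + 2))"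
    using psi1_even[OF a, of "t + (a + 2)"] by (metis minus_add_distrib diff_conv_add_uminus)
  also have "\<dots> = psi1 a (t - (a + 2))"
    using psi1_periodic[OF a, of "t - (a + 2)"] by (simp add: algebra_simps)
  finally show ?case by (simp add: bump_0_eq_psi1)
next
  case (Suc n)
  have "((\<lambda>s. bump a (Suc n) (- s)) has_real_derivative bump a n (- s - c)) (at s)" for s
    using DERIV_chain2[OF bump_deriv[of n "- s"] DERIV_minus[OF DERIV_ident]] by simp
  moreover have "bump a n (- s - c) = - bump a n (s - c)" for s
  proof -
    have "bump a n (- s - c) = bump a n (s + c)"
      using Suc[of "s + c"] by (metis minus_add_distrib diff_conv_add_uminus)
    also have "s + c = (s - c) + 2 * c" by simp
    finally show ?thesis by (simp only: bump_antiperiodic)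
  qed
  ultimately have "((\<lambda>s. bump a (Suc n) (- s) - bump a (Suc n) s) has_real_derivative 0) (at s)" for s
    using bump_deriv[of n s] by (auto intro!: derivative_eq_intros)
  from DERIV_isconst_all[rule_format, OF this, of t 0] show ?case by simp
qed

lemma bump_0: "0 \<le> t \<Longrightarrow> t \<le> c \<Longrightarrow> bump a 0 t = max 0 (1 - t)"
  using psi1_fundamental[OF a, of "t - (a + 2)"] a
  by (auto simp: bump_0_eq_psi1 c_def psi1_base_def max_def)

lemma bump_reflect: "bump a n (2 * c - t) = - bump a n t"
  using bump_antiperiodic[of n "- t"] bump_even[of n t] by (simp add: algebra_simps)

lemma bump_zero_at_c: "bump a n c = 0"
  using bump_reflect[of n c] by simp

text \<open>
  On \<open>[0, 2 * c]\<close> the derivative of a bump is the negative of the previous bump on its half wave around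
  \<open>0\<close>. So the bump decreases there, strictly near the zero at \<open>c\<close>.
\<close>

lemma bump_profile:
  "(\<forall>t. \<bar>t\<bar> \<le> c \<longrightarrow> bump a n t \<ge> 0) \<and> (\<forall>t. \<bar>t\<bar> < foot a n \<longrightarrow> bump a n t > 0)"
proof (induction n)
  case 0
  have "bump a 0 t = max 0 (1 - \<bar>t\<bar>)" if "\<bar>t\<bar> \<le> c" for t
    using bump_0[of "\<bar>t\<bar>"] bump_even[of 0 t] that by (cases "t \<ge> 0") auto
  then show ?case using c_ge_1 by (auto simp: foot_def)
next
  case (Suc n)
  have pos: "bump a (Suc n) t > 0" if "0 \<le> t" "t < c" for t
  proof -
    define u where "u = max t (c - foot a n)"
    have "bump a (Suc n) u \<le> bump a (Suc n) t"
    proof (rule DERIV_nonpos_imp_nonincreasing[where f = "bump a (Suc n)"])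
      show "t \<le> u" by (simp add: u_def)
      fix s assume "t \<le> s" "s \<le> u"
      then have "\<bar>s - c\<bar> \<le> c" using that foot_bounds[of n] by (auto simp: u_def)
      then show "\<exists>y. DERIV (bump a (Suc n)) s :> y \<and> y \<le> 0"
        using bump_deriv[of n s] Suc by (intro exI[of _ "- bump a n (s - c)"]) auto
    qed
    moreover have "bump a (Suc n) c < bump a (Suc n) u"
    proof (rule DERIV_neg_imp_decreasing_open[where f = "bump a (Suc n)"])
      show "u < c" using that foot_bounds[of n] by (auto simp: u_def)
      fix s assume "u < s" "s < c"
      then have "\<bar>s - c\<bar> < foot a n" by (auto simp: u_def)
      then show "\<exists>y. DERIV (bump a (Suc n)) s :> y \<and> y < 0"
        using bump_deriv[of n s] Suc by (intro exI[of _ "- bump a n (s - c)"]) auto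
    qed (rule bump_continuous)
    ultimately show ?thesis using bump_zero_at_c[of "Suc n"] by simp
  qed
  have "bump a (Suc n) t > 0" if "\<bar>t\<bar> < c" for t
    using pos[of "\<bar>t\<bar>"] bump_even[of "Suc n" t] that by (cases "t \<ge> 0") auto
  moreover have "bump a (Suc n) t = 0" if "\<bar>t\<bar> = c" for t
    using bump_zero_at_c[of "Suc n"] bump_even[of "Suc n" t] that by (cases "t \<ge> 0") auto
  ultimately show ?case
    by (auto simp: foot_def c_def[symmetric] less_eq_real_def)
qed

lemma bump_nonneg: "\<bar>t\<bar> \<le> c \<Longrightarrow> bump a n t \<ge> 0"
  and bump_pos: "\<bar>t\<bar> < foot a n \<Longrightarrow> bump a n t > 0"
  using bump_profile by auto

lemma bump_peak_pos: "bump a n 0 > 0"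
  using bump_pos[of 0 n] foot_bounds[of n] by simp

lemma bump_Suc_antimono:
  assumes "0 \<le> s" "s \<le> t" "t \<le> 2 * c"
  shows "bump a (Suc n) t \<le> bump a (Suc n) s"
proof (rule DERIV_nonpos_imp_nonincreasing[where f = "bump a (Suc n)"])
  fix u assume "s \<le> u" "u \<le> t"
  then show "\<exists>y. DERIV (bump a (Suc n)) u :> y \<and> y \<le> 0"
    using bump_deriv[of n u] bump_nonneg[of "u - c" n] assms
    by (intro exI[of _ "- bump a n (u - c)"]) auto
qed (use assms in auto)

text \<open>
  Level \<open>1\<close> is excluded, since its derivative vanishes where the bump on level \<open>0\<close> does, next to the peak.
\<close>

lemma bump_less_peak:
  assumes "n \<noteq> 1" "0 < t" "t \<le> c"
  shows "bump a n t < bump a n 0"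
proof (cases n)
  case 0
  then show ?thesis using assms c_ge_1 by (simp add: bump_0)
next
  case (Suc k)
  then obtain j where k: "k = Suc j" using assms(1) by (cases k) auto
  show ?thesis unfolding Suc
  proof (rule DERIV_neg_imp_decreasing_open[where f = "bump a (Suc k)"])
    fix s assume "0 < s" "s < t"
    then have "\<bar>s - c\<bar> < foot a k" using assms unfolding k by (auto simp: foot_def c_def)
    then show "\<exists>y. DERIV (bump a (Suc k)) s :> y \<and> y < 0"
      using bump_deriv[of k s] bump_pos by (intro exI[of _ "- bump a k (s - c)"]) auto
  qed (use assms bump_continuous in auto)
qed

lemma bump_le_peak: "\<bar>bump a n t\<bar> \<le> bump a n 0"
proof -
  have *: "\<bar>bump a n t\<bar> \<le> bump a n 0" if "0 \<le> t" "t \<le> c" for t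
  proof (cases "n = 0")
    case True
    then show ?thesis using that bump_0 c_ge_1 by auto
  next
    case False
    then obtain k where "n = Suc k" using not0_implies_Suc by auto
    then show ?thesis using bump_Suc_antimono[of 0 t k] bump_nonneg[of t n] that c_ge_1 by auto
  qed
  have **: "\<bar>bump a n t\<bar> \<le> bump a n 0" if "\<bar>t\<bar> \<le> c" for t
    using *[of "\<bar>t\<bar>"] bump_even[of n t] that by (cases "t \<ge> 0") auto
  have shift: "\<bar>bump a n (t + 2 * c * real k)\<bar> = \<bar>bump a n t\<bar>" for t k
  proof (induction k)
    case (Suc k)
    have "t + 2 * c * real (Suc k) = (t + 2 * c * real k) + 2 * c" by (simp add: algebra_simps)
    then have "bump a n (t + 2 * c * real (Suc k)) = - bump a n (t + 2 * c * real k)"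
      by (simp only: bump_antiperiodic)
    then show ?case using Suc by simp
  qed simp
  define k where "k = round (t / (2 * c))"
  have "\<bar>t - 2 * c * of_int k\<bar> = 2 * c * \<bar>of_int k - t / (2 * c)\<bar>"
    using abs_diff_multiple[of "2 * c" t "of_int k"] c_ge_1 by (simp add: abs_minus_commute)
  also have "\<dots> \<le> 2 * c * (1 / 2)"
    unfolding k_def using of_int_round_abs_le[of "t / (2 * c)"] c_ge_1 by (intro mult_left_mono) auto
  finally have small: "\<bar>t - 2 * c * of_int k\<bar> \<le> c" by simp
  have "\<bar>bump a n t\<bar> = \<bar>bump a n (t - 2 * c * of_int k)\<bar>"
  proof (cases "k \<ge> 0")
    case True
    then show ?thesis using shift[of "t - 2 * c * of_int k" "nat k"] by simp
  next
    case False
    then show ?thesis using shift[of t "nat (- k)"] by simp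
  qed
  with **[OF small] show ?thesis by simp
qed

text \<open>
  Only for \<open>n = 0\<close> can \<open>w\<close> be smaller than \<open>c\<close>. These are the flat tops of the spline on level \<open>1\<close>,
  caused by the zeros between the triangular humps of level \<open>0\<close>. Thus a spline runs from its maximum to
  its minimum while its derivative crosses the hump of the level below.
\<close>

lemma bump_Suc_plateau:
  assumes "foot a n \<le> w" "w \<le> c"
  shows "bump a (Suc n) (c - w) = bump a (Suc n) 0" "bump a (Suc n) (c + w) = - bump a (Suc n) 0"
proof -
  show *: "bump a (Suc n) (c - w) = bump a (Suc n) 0"
  proof (cases n)
    case 0
    have zero: "bump a 0 (s - c) = 0" if "0 \<le> s" "s \<le> c - w" for s
      using bump_0[of "c - s"] bump_even[of 0 "c - s"] that assms 0 by (auto simp: foot_def)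
    have "bump a (Suc n) 0 \<le> bump a (Suc n) (c - w)"
    proof (rule DERIV_nonneg_imp_nondecreasing[where f = "bump a (Suc n)"])
      fix s assume "0 \<le> s" "s \<le> c - w"
      then show "\<exists>y. DERIV (bump a (Suc n)) s :> y \<and> y \<ge> 0"
        using bump_deriv[of n s] zero[of s] 0 by auto
    qed (use assms in auto)
    then show ?thesis using bump_le_peak[of "Suc n" "c - w"] by simp
  next
    case (Suc m)
    then show ?thesis using assms by (simp add: foot_def c_def)
  qed
  then show "bump a (Suc n) (c + w) = - bump a (Suc n) 0"
    using bump_reflect[of "Suc n" "c - w"] by (simp add: algebra_simps)
qed

end

section \<open>Comparison of functions with the splines\<close>

lemma DERIV_affine:
  assumes "\<And>t. (f has_real_derivative f' t) (at t)"
  shows "((\<lambda>u. f (s + e * u)) has_real_derivative e * f' (s + e * u)) (at u)"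
proof -
  have "((\<lambda>u. s + e * u) has_real_derivative e) (at u)"
    by (auto intro!: derivative_eq_intros)
  from DERIV_chain2[OF assms this] show ?thesis by (simp add: mult.commute)
qed

text \<open>
  After the last point with \<open>f \<ge> 0\<close> the function would have to be negative, but it vanishes at this point
  and increases there.
\<close>

lemma nonneg_barrier:
  fixes f f' :: "real \<Rightarrow> real"
  assumes deriv: "\<And>v. 0 \<le> v \<Longrightarrow> v \<le> U \<Longrightarrow> (f has_real_derivative f' v) (at v)"
    and start: "f 0 \<ge> 0"
    and up: "\<And>v. 0 \<le> v \<Longrightarrow> v \<le> U \<Longrightarrow> f v = 0 \<Longrightarrow> f' v > 0"
    and u: "0 \<le> u" "u \<le> U"
  shows "f u \<ge> 0"
proof (rule ccontr)
  assume neg: "\<not> f u \<ge> 0"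
  define S where "S = {0..u} \<inter> f -` {0..}"
  have cont: "continuous_on {0..u} f"
    using deriv u by (fastforce intro: continuous_at_imp_continuous_on DERIV_isCont)
  have "closed S"
    unfolding S_def by (rule continuous_closed_preimage[OF cont]) auto
  moreover have "S \<noteq> {}" "bdd_above S"
    using start u unfolding S_def by (auto intro: bdd_aboveI[of _ u])
  ultimately have "Sup S \<in> S" by (rule closed_contains_Sup[rotated -1])
  define w where "w = Sup S"
  have w: "0 \<le> w" "w < u" "f w \<ge> 0"
    using \<open>Sup S \<in> S\<close>[folded w_def] neg unfolding S_def by (auto simp: less_eq_real_def)
  have after: "f v < 0" if "w < v" "v \<le> u" for v
    using that w cSup_upper[OF _ \<open>bdd_above S\<close>, of v] unfolding w_def S_def by force
  have "\<not> f w > 0"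
  proof
    assume "f w > 0"
    have "continuous_on {w..u} f" using cont w by (auto intro: continuous_on_subset)
    then obtain v where "w \<le> v" "v \<le> u" "f v = 0"
      using IVT2'[of f u 0 w] neg \<open>f w > 0\<close> w by force
    with after[of v] \<open>f w > 0\<close> show False by (cases "v = w") auto
  qed
  then have "f w = 0" using w by simp
  with up[of w] w u have "f' w > 0" by simp
  then obtain d where d: "d > 0" "\<And>h. 0 < h \<Longrightarrow> h < d \<Longrightarrow> f w < f (w + h)"
    using DERIV_pos_inc_right[OF deriv[of w]] w u by auto
  define h where "h = min (d / 2) (u - w)"
  have "0 < h" "h < d" "w + h \<le> u" using d w by (auto simp: h_def)
  then show False using d(2)[of h] after[of "w + h"] \<open>f w = 0\<close> by simp
qed

text \<open>
  Replacing \<open>f\<close> by its difference \<open>f (t + 1) - f t\<close> doubles the bound and, by the mean value theorem, turns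
  values of the derivative of order \<open>k\<close> of the difference into values of that of order \<open>k + 1\<close> of \<open>f\<close>.
\<close>

lemma small_derivative_point:
  fixes f :: "nat \<Rightarrow> real \<Rightarrow> real"
  assumes "\<And>i t. i < k \<Longrightarrow> (f i has_real_derivative f (Suc i) t) (at t)"
    and "\<And>t. \<bar>f 0 t\<bar> \<le> B"
  shows "\<exists>\<xi>. s \<le> \<xi> \<and> \<xi> \<le> s + real k \<and> \<bar>f k \<xi>\<bar> \<le> 2 ^ k * B"
  using assms
proof (induction k arbitrary: f B)
  case 0
  then show ?case by auto
next
  case (Suc k)
  define g where "g i t = f i (t + 1) - f i t" for i t
  have "(g i has_real_derivative g (Suc i) t) (at t)" if "i < k" for i t
    unfolding g_def using that DERIV_shift[THEN iffD1, OF Suc.prems(1)[of i "t + 1"]]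
    by (intro DERIV_diff Suc.prems(1)) auto
  moreover have "\<bar>g 0 t\<bar> \<le> 2 * B" for t
    using Suc.prems(2)[of t] Suc.prems(2)[of "t + 1"] unfolding g_def by linarith
  ultimately obtain \<xi> where xi: "s \<le> \<xi>" "\<xi> \<le> s + real k" "\<bar>g k \<xi>\<bar> \<le> 2 ^ k * (2 * B)"
    using Suc.IH[of g "2 * B"] by auto
  obtain \<eta> where "\<xi> < \<eta>" "\<eta> < \<xi> + 1" "g k \<xi> = f (Suc k) \<eta>"
    using MVT2[of "\<xi>" "\<xi> + 1" "f k" "f (Suc k)"] Suc.prems(1)[of k] unfolding g_def by auto
  then show ?case using xi by (intro exI[of _ \<eta>]) (auto simp: mult_ac)
qed

text \<open>
  A crude form of the inequalities between the norms of derivatives, which ensures that the supremum in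
  \<open>derivative_bound\<close> is finite. Every interval of length \<open>n - j\<close> contains a point where \<open>G j\<close> is small, and the
  Lipschitz bound carries this over to the whole interval. The bound just found makes the next level
  Lipschitz.
\<close>

lemma intermediate_derivatives_bounded:
  fixes G :: "nat \<Rightarrow> real \<Rightarrow> real"
  assumes deriv: "\<And>i t. i < n \<Longrightarrow> (G (Suc i) has_real_derivative G i t) (at t)"
    and lip: "\<And>s t. \<bar>G 0 s - G 0 t\<bar> \<le> \<mu> * \<bar>s - t\<bar>"
    and bounded: "\<And>t. \<bar>G n t\<bar> \<le> B"
    and "j \<le> n"
  shows "\<exists>C. \<forall>t. \<bar>G j t\<bar> \<le> C"
  using \<open>j \<le> n\<close>
proof (induction j)
  have *: "\<exists>C. \<forall>t. \<bar>G j t\<bar> \<le> C"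
    if j: "j \<le> n" and L: "\<And>s t. \<bar>G j s - G j t\<bar> \<le> L * \<bar>s - t\<bar>" for j L
  proof (intro exI allI)
    fix t
    have "(G (n - i) has_real_derivative G (n - Suc i) t) (at t)" if "i < n - j" for i t
    proof -
      have "n - i = Suc (n - Suc i)" using that by simp
      then show ?thesis using deriv[of "n - Suc i" t] that by simp
    qed
    then obtain \<xi> where xi: "t \<le> \<xi>" "\<xi> \<le> t + real (n - j)" "\<bar>G j \<xi>\<bar> \<le> 2 ^ (n - j) * B"
      using small_derivative_point[of "n - j" "\<lambda>i. G (n - i)" B t] bounded j by auto
    have "L \<ge> 0" using L[of 1 0] by simp
    then have "L * \<bar>t - \<xi>\<bar> \<le> L * real (n - j)" using xi by (intro mult_left_mono) auto
    with L[of t \<xi>] xi(3) show "\<bar>G j t\<bar> \<le> 2 ^ (n - j) * B + L * real (n - j)" by linarith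
  qed
  {
    case 0
    then show ?case using * lip by blast
  next
    case (Suc j)
    then obtain C where C: "\<And>t. \<bar>G j t\<bar> \<le> C" by auto
    have "\<bar>G (Suc j) s - G (Suc j) t\<bar> \<le> C * \<bar>s - t\<bar>" for s t
      using field_differentiable_bound[of UNIV "G (Suc j)" "G j" C s t] deriv[of j] C Suc.prems
      by (simp add: has_field_derivative_at_within)
    with Suc.prems show ?case using * by blast
  }
qed

text \<open>
  Indices count integrations: \<open>G 0\<close> is the lowest derivative considered and \<open>G n\<close> the function itself. The
  factor \<open>\<mu>\<close> leaves room below the extremal splines, which belong to \<open>\<mu> = 1\<close>. The condition on \<open>G 1\<close>
  makes up for the flat top of the spline on that level.
\<close>

definition spline_class :: "real \<Rightarrow> real \<Rightarrow> nat \<Rightarrow> (nat \<Rightarrow> real \<Rightarrow> real) \<Rightarrow> bool" where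
  "spline_class a \<mu> n G \<longleftrightarrow>
     (\<forall>j<n. \<forall>t. (G (Suc j) has_real_derivative G j t) (at t)) \<and>
     (\<forall>s t. \<bar>G 0 s - G 0 t\<bar> \<le> \<mu> * \<bar>s - t\<bar>) \<and>
     (n \<ge> 1 \<longrightarrow> (\<forall>t. \<bar>G 1 t\<bar> \<le> \<mu> * bump a 1 0)) \<and>
     (\<forall>t. \<bar>G n t\<bar> \<le> \<mu> * bump a n 0)"

lemma spline_class_uminus:
  assumes "spline_class a \<mu> n G"
  shows "spline_class a \<mu> n (\<lambda>j t. - G j t)"
  using assms unfolding spline_class_def by (auto intro!: DERIV_minus simp: abs_minus_commute)

context
  fixes a c :: real
  assumes a: "a \<ge> 0"
  defines "c \<equiv> a / 2 + 1"
begin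

lemmas c_foot_bounds = c_ge_1[OF a, folded c_def] foot_bounds[OF a, folded c_def]
lemmas peak_pos = bump_peak_pos[OF a]

text \<open>
  If the function on level \<open>n\<close> is at least as high as the spline at the point \<open>t\<close> of its
  hump, it stays above the descending branch of the spline to both sides. This is required only up to the
  foot of the hump: on level \<open>0\<close> it can fail beyond it, as a Lipschitz function need not follow the stretch
  of zeros.
\<close>

definition slow_descent :: "nat \<Rightarrow> bool" where
  "slow_descent n \<longleftrightarrow> (\<forall>\<mu> G s t u. \<mu> < 1 \<longrightarrow> spline_class a \<mu> n G \<longrightarrow> G n s \<ge> bump a n t \<longrightarrow>
     0 \<le> t \<longrightarrow> 0 \<le> u \<longrightarrow> t + u \<le> foot a n \<longrightarrow>
     G n (s + u) \<ge> bump a n (t + u) \<and> G n (s - u) \<ge> bump a n (t + u))"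

lemma slow_descent_0: "slow_descent 0"
  unfolding slow_descent_def
proof (intro allI impI)
  fix \<mu> s t u :: real and G
  assume "\<mu> < 1" and G: "spline_class a \<mu> 0 G" and ge: "bump a 0 t \<le> G 0 s"
    and t: "0 \<le> t" "0 \<le> u" "t + u \<le> foot a 0"
  then have le: "t + u \<le> 1" by (simp add: foot_def)
  have "\<mu> * u \<le> 1 * u" using \<open>\<mu> < 1\<close> t by (intro mult_right_mono) auto
  moreover have "\<bar>G 0 (s + u) - G 0 s\<bar> \<le> \<mu> * \<bar>s + u - s\<bar>" "\<bar>G 0 (s - u) - G 0 s\<bar> \<le> \<mu> * \<bar>s - u - s\<bar>"
    using G unfolding spline_class_def by blast+
  moreover have "bump a 0 t = 1 - t" "bump a 0 (t + u) = 1 - (t + u)"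
    using bump_0[OF a] t le c_foot_bounds by (auto simp: c_def)
  ultimately show "bump a 0 (t + u) \<le> G 0 (s + u) \<and> bump a 0 (t + u) \<le> G 0 (s - u)"
    using ge t by (auto simp: abs_le_iff)
qed

text \<open>
  Suppose that the supremum \<open>M\<close> of \<open>\<bar>G n\<bar>\<close> exceeds the bound. Scaled by \<open>\<kappa>\<close>, the
  supremum becomes \<open>\<rho>\<close> times the peak of \<open>bump a n\<close>, with \<open>\<rho> < 1\<close>, while the scaled \<open>G (n + 1)\<close> is
  bounded by \<open>\<rho> * q\<close> times the peak of \<open>bump a (n + 1)\<close>, where \<open>q < 1\<close> does not depend on \<open>\<rho>\<close>. On the
  other hand, slow descent to both sides of a point where \<open>G n\<close> is nearly maximal gives the scaled \<open>G (n + 1)\<close> an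
  oscillation close to twice the peak of \<open>bump a (n + 1)\<close>.
\<close>

lemma derivative_bound:
  assumes D: "slow_descent n" and G: "spline_class a \<mu> (Suc n) G"
  shows "\<bar>G n s\<bar> \<le> \<mu> * bump a n 0"
proof (cases "n = 1")
  case True
  then show ?thesis using G by (simp add: spline_class_def)
next
  case n: False
  let ?A = "bump a n 0" and ?B = "bump a (Suc n) 0"
  have deriv: "(G (Suc j) has_real_derivative G j t) (at t)" if "j \<le> n" for j t
    using G that by (simp add: spline_class_def)
  have lip: "\<bar>G 0 s - G 0 t\<bar> \<le> \<mu> * \<bar>s - t\<bar>" for s t
    using G unfolding spline_class_def by blast
  have top: "\<bar>G (Suc n) t\<bar> \<le> \<mu> * ?B" for t
    using G by (simp add: spline_class_def)
  have mu: "\<mu> \<ge> 0" using lip[of 1 0] by simp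
  have "\<exists>C. \<forall>t. \<bar>G n t\<bar> \<le> C"
    by (rule intermediate_derivatives_bounded[of "Suc n" G \<mu> "\<mu> * ?B"]) (use deriv lip top in auto)
  then have bdd: "bdd_above (range (\<lambda>t. \<bar>G n t\<bar>))"
    by (auto simp: bdd_above_def)
  define M where "M = (SUP t. \<bar>G n t\<bar>)"
  have le_M: "\<bar>G n t\<bar> \<le> M" for t
    unfolding M_def by (rule cSUP_upper[OF _ bdd]) simp
  have "M \<le> \<mu> * ?A"
  proof (rule ccontr)
    assume "\<not> M \<le> \<mu> * ?A"
    then have M: "\<mu> * ?A < M" by simp
    have A: "?A > 0" and B: "?B > 0" by (rule peak_pos)+
    have "M > 0" using M mu A by (smt (verit) mult_nonneg_nonneg)
    define q where "q = \<mu> * ?A / M"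
    have q: "0 \<le> q" "q < 1" using M mu A \<open>M > 0\<close> by (auto simp: q_def)
    define Q where "Q v = bump a (Suc n) (c - v)" for v
    have Q_deriv: "(Q has_real_derivative bump a n v) (at v)" for v
    proof -
      have "((\<lambda>v. c - v) has_real_derivative - 1) (at v)"
        by (auto intro!: derivative_eq_intros)
      from DERIV_chain2[OF bump_deriv[OF a, folded c_def] this, of n] show ?thesis
        unfolding Q_def using bump_even[OF a, of n v] by simp
    qed
    have Q0: "Q 0 = 0" using bump_zero_at_c[OF a, folded c_def] by (simp add: Q_def)
    have Qz: "Q (foot a n) = ?B"
      using bump_Suc_plateau(1)[OF a, of n "foot a n", folded c_def] c_foot_bounds by (simp add: Q_def)
    have "(Q \<longlongrightarrow> 0) (at_right 0)"
      using DERIV_isCont[OF Q_deriv[of 0]] unfolding isCont_def Q0 filterlim_at_split by simp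
    moreover have "(1 - q) * ?B > 0" using q B by simp
    ultimately have "eventually (\<lambda>v. Q v < (1 - q) * ?B) (at_right 0)"
      by (rule order_tendstoD(2))
    then obtain d where d: "d > 0" "\<And>v. 0 < v \<Longrightarrow> v < d \<Longrightarrow> Q v < (1 - q) * ?B"
      unfolding eventually_at_right_field by auto
    \<comment> \<open>Up to the point \<open>t\<close> the spline \<open>Q\<close>, which rises from \<open>0\<close> to its peak, has gained less than the
      fraction \<open>1 - q\<close> of this peak.\<close>
    define t where "t = min d (foot a n) / 2"
    have t: "0 < t" "t < foot a n" "Q t < (1 - q) * ?B"
      using d c_foot_bounds(2)[of n] by (auto simp: t_def)
    have "bump a n t < ?A"
      using bump_less_peak[OF a n] t c_foot_bounds(3)[of n] by (auto simp: c_def)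
    \<comment> \<open>With this choice the scaled supremum, \<open>\<rho>\<close> times the peak, exceeds the height of the
      hump at \<open>t\<close>, so \<open>G n\<close> reaches that height.\<close>
    then obtain \<rho> where rho: "bump a n t / ?A < \<rho>" "\<rho> < 1"
      using A dense[of "bump a n t / ?A" 1] by auto
    have "bump a n t > 0" using bump_pos[OF a, of t n] t by simp
    then have "\<rho> > 0" using rho A by (smt (verit) divide_pos_pos)
    define \<kappa> where "\<kappa> = \<rho> * ?A / M"
    have kappa: "\<kappa> > 0" "\<kappa> * M = \<rho> * ?A" "\<kappa> * \<mu> = \<rho> * q"
      using \<open>\<rho> > 0\<close> A \<open>M > 0\<close> by (auto simp: \<kappa>_def q_def)
    have kmu: "\<kappa> * \<mu> \<le> \<rho>" using kappa(3) q \<open>\<rho> > 0\<close> by simp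
    have "bump a n t / \<kappa> < M"
      using rho A kappa by (simp add: field_simps)
    then obtain s where "bump a n t / \<kappa> < \<bar>G n s\<bar>"
      using less_cSUP_iff[OF _ bdd] unfolding M_def by auto
    then have s: "bump a n t < \<kappa> * \<bar>G n s\<bar>" using kappa by (simp add: field_simps)
    define \<sigma> :: real where "\<sigma> = (if G n s \<ge> 0 then \<kappa> else - \<kappa>)"
    have sigma: "\<bar>\<sigma>\<bar> = \<kappa>" "bump a n t < \<sigma> * G n s"
      using s kappa by (auto simp: \<sigma>_def abs_if split: if_splits)
    have scaled: "\<bar>\<sigma> * y\<bar> \<le> \<rho> * C" if "\<bar>y\<bar> \<le> \<mu> * C" "0 \<le> C" for y C
    proof -
      have "\<bar>\<sigma> * y\<bar> \<le> \<kappa> * (\<mu> * C)"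
        using that kappa sigma by (auto simp: abs_mult intro: mult_left_mono)
      also have "\<dots> \<le> \<rho> * C" using mult_right_mono[OF kmu that(2)] by (simp add: mult_ac)
      finally show ?thesis .
    qed
    have "spline_class a \<rho> n (\<lambda>j t. \<sigma> * G j t)"
      unfolding spline_class_def
    proof (intro conjI allI impI)
      fix j u assume "j < n"
      then show "((\<lambda>t. \<sigma> * G (Suc j) t) has_real_derivative \<sigma> * G j u) (at u)"
        using deriv[of j u] by (intro DERIV_cmult) auto
    next
      fix u v
      show "\<bar>\<sigma> * G 0 u - \<sigma> * G 0 v\<bar> \<le> \<rho> * \<bar>u - v\<bar>"
        using scaled[OF lip[of u v]] by (simp add: right_diff_distrib)
    next
      fix u
      have "\<bar>G 1 u\<bar> \<le> \<mu> * bump a 1 0" using G by (simp add: spline_class_def)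
      then show "\<bar>\<sigma> * G 1 u\<bar> \<le> \<rho> * bump a 1 0"
        using scaled peak_pos[of 1] by simp
    next
      fix u
      have "\<bar>\<sigma> * G n u\<bar> \<le> \<kappa> * M"
        using mult_left_mono[OF le_M[of u], of \<kappa>] kappa sigma by (simp add: abs_mult)
      then show "\<bar>\<sigma> * G n u\<bar> \<le> \<rho> * ?A" using kappa by simp
    qed
    then have wide: "bump a n (t + u) \<le> \<sigma> * G n (s + u)" "bump a n (t + u) \<le> \<sigma> * G n (s - u)"
      if "0 \<le> u" "t + u \<le> foot a n" for u
      using D that t rho sigma unfolding slow_descent_def by (smt (verit, best))+
    define w where "w = foot a n - t"
    have w: "w > 0" "t + w = foot a n" using t by (auto simp: w_def)
    have "\<sigma> * G (Suc n) (s + 0) - \<sigma> * G (Suc n) (s - 0) - 2 * Q (t + 0)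
        \<le> \<sigma> * G (Suc n) (s + w) - \<sigma> * G (Suc n) (s - w) - 2 * Q (t + w)"
    proof (rule DERIV_nonneg_imp_nondecreasing[where
          f = "\<lambda>v. \<sigma> * G (Suc n) (s + v) - \<sigma> * G (Suc n) (s - v) - 2 * Q (t + v)"])
      fix v assume v: "0 \<le> v" "v \<le> w"
      have "((\<lambda>v. \<sigma> * G (Suc n) (s + v) - \<sigma> * G (Suc n) (s - v) - 2 * Q (t + v))
          has_real_derivative \<sigma> * G n (s + v) + \<sigma> * G n (s - v) - 2 * bump a n (t + v)) (at v)"
        using DERIV_diff[OF DERIV_diff[OF
            DERIV_cmult[OF DERIV_affine[OF deriv[OF order_refl], of s 1 v], of \<sigma>]
            DERIV_cmult[OF DERIV_affine[OF deriv[OF order_refl], of s "- 1" v], of \<sigma>]]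
            DERIV_cmult[OF DERIV_affine[OF Q_deriv, of t 1 v], of 2]]
        by simp
      then show "\<exists>y. ((\<lambda>v. \<sigma> * G (Suc n) (s + v) - \<sigma> * G (Suc n) (s - v) - 2 * Q (t + v))
          has_real_derivative y) (at v) \<and> 0 \<le> y"
        using wide[of v] v w
        by (intro exI[of _ "\<sigma> * G n (s + v) + \<sigma> * G n (s - v) - 2 * bump a n (t + v)"] conjI) auto
    qed (use w in auto)
    then have "2 * ?B - 2 * Q t \<le> \<sigma> * G (Suc n) (s + w) - \<sigma> * G (Suc n) (s - w)"
      using w Qz by simp
    also have "\<dots> \<le> \<bar>\<sigma> * G (Suc n) (s + w)\<bar> + \<bar>\<sigma> * G (Suc n) (s - w)\<bar>" by simp
    also have "\<dots> \<le> \<kappa> * (\<mu> * ?B) + \<kappa> * (\<mu> * ?B)"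
      using top kappa sigma by (intro add_mono) (auto simp: abs_mult intro: mult_left_mono)
    also have "\<dots> = \<rho> * (2 * q * ?B)" using kappa(3) by (metis (no_types, lifting) mult.assoc mult.commute mult_2)
    also have "\<dots> \<le> 1 * (2 * q * ?B)" using rho q B by (intro mult_right_mono) auto
    finally show False using t(3) by (simp add: algebra_simps)
  qed
  then show ?thesis using le_M[of s] by simp
qed

lemma spline_class_derivative:
  assumes "slow_descent n" "spline_class a \<mu> (Suc n) G"
  shows "spline_class a \<mu> n G"
  using assms(2) derivative_bound[OF assms] by (auto simp: spline_class_def)

text \<open>
  Here \<open>w\<close> is the position on the hump of the spline's derivative. If \<open>G n\<close> were too negative at \<open>s\<close>, it
  would stay so, by slow descent, until the spline's derivative has run out at the foot of the hump. When
  \<open>w \<ge> 0\<close> this is used to the right of \<open>s\<close>, where \<open>G (n + 1)\<close> falls to the minimum of the spline. When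
  \<open>w < 0\<close> it is used to the left, where \<open>G (n + 1)\<close> was at least as large as the maximum. Both values are
  excluded by \<open>\<mu> < 1\<close>.
\<close>

lemma comparison_one_sided:
  assumes D: "slow_descent n" and mu: "\<mu> < 1" and G: "spline_class a \<mu> (Suc n) G"
    and t: "0 \<le> t" "t \<le> 2 * c" and eq: "G (Suc n) s = bump a (Suc n) t"
  shows "- bump a n (t - c) < G n s"
proof (rule ccontr)
  let ?B = "bump a (Suc n) 0" and ?z = "foot a n"
  define w where "w = t - c"
  assume "\<not> - bump a n (t - c) < G n s"
  then have ge: "bump a n w \<le> - G n s" by (simp add: w_def)
  have below: "\<bar>G (Suc n) u\<bar> < ?B" for u
  proof -
    have "\<bar>G (Suc n) u\<bar> \<le> \<mu> * ?B" using G by (simp add: spline_class_def)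
    also have "\<dots> < 1 * ?B" using mu peak_pos by (intro mult_strict_right_mono)
    finally show ?thesis by simp
  qed
  have deriv: "(G (Suc n) has_real_derivative G n t) (at t)" for t
    using G by (simp add: spline_class_def)
  have bump': "(bump a (Suc n) has_real_derivative - bump a n (t - c)) (at t)" for t
    using bump_deriv[OF a] by (simp add: c_def)
  note plateau = bump_Suc_plateau[OF a, folded c_def]
  have G': "spline_class a \<mu> n (\<lambda>j t. - G j t)"
    by (rule spline_class_uminus[OF spline_class_derivative[OF D G]])
  have descent: "bump a n (\<bar>w\<bar> + u) \<le> - G n (s + u)" "bump a n (\<bar>w\<bar> + u) \<le> - G n (s - u)"
    if "0 \<le> u" "\<bar>w\<bar> + u \<le> ?z" for u
  proof -
    have "bump a n \<bar>w\<bar> \<le> - G n s" using ge bump_even[OF a, of n w] by (cases "w \<ge> 0") auto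
    then show "bump a n (\<bar>w\<bar> + u) \<le> - G n (s + u)" "bump a n (\<bar>w\<bar> + u) \<le> - G n (s - u)"
      using D[unfolded slow_descent_def, rule_format, OF mu G', of "\<bar>w\<bar>" s u] that by auto
  qed
  \<comment> \<open>In the first case the spline is at its maximum or minimum, which \<open>G (n + 1)\<close> does not attain.\<close>
  consider "?z \<le> \<bar>w\<bar>" | "0 \<le> w" "w < ?z" | "w < 0" "- w < ?z" by linarith
  then show False
  proof cases
    case 1
    then have "\<bar>bump a (Suc n) t\<bar> = ?B"
      using plateau[of n "\<bar>w\<bar>"] t peak_pos[of "Suc n"] unfolding w_def by (auto simp: abs_if split: if_splits)
    then show False using below[of s] eq by simp
  next
    case 2
    define v where "v = ?z - w"
    have "G (Suc n) (s + v) - bump a (Suc n) (t + v) \<le> G (Suc n) (s + 0) - bump a (Suc n) (t + 0)"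
    proof (rule DERIV_nonpos_imp_nonincreasing[where
          f = "\<lambda>u. G (Suc n) (s + u) - bump a (Suc n) (t + u)"])
      fix u assume u: "0 \<le> u" "u \<le> v"
      have "((\<lambda>u. G (Suc n) (s + u) - bump a (Suc n) (t + u)) has_real_derivative
          G n (s + u) + bump a n (w + u)) (at u)"
        using DERIV_diff[OF DERIV_affine[OF deriv, of s 1 u] DERIV_affine[OF bump', of t 1 u]]
        by (simp add: w_def add.commute add_diff_eq diff_add_eq)
      then show "\<exists>y. ((\<lambda>u. G (Suc n) (s + u) - bump a (Suc n) (t + u)) has_real_derivative y) (at u) \<and> y \<le> 0"
        using descent(1)[of u] u 2 by (intro exI conjI) (auto simp: v_def)
    qed (use 2 in \<open>auto simp: v_def\<close>)
    moreover have "t + v = c + ?z" by (simp add: v_def w_def)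
    ultimately have "G (Suc n) (s + v) \<le> - ?B"
      using plateau(2)[of n ?z] c_foot_bounds(3)[of n] eq by simp
    then show False using below[of "s + v"] by simp
  next
    case 3
    define v where "v = ?z + w"
    have "G (Suc n) (s - 0) - bump a (Suc n) (t - 0) \<le> G (Suc n) (s - v) - bump a (Suc n) (t - v)"
    proof (rule DERIV_nonneg_imp_nondecreasing[where
          f = "\<lambda>u. G (Suc n) (s - u) - bump a (Suc n) (t - u)"])
      fix u assume u: "0 \<le> u" "u \<le> v"
      have "((\<lambda>u. G (Suc n) (s - u) - bump a (Suc n) (t - u)) has_real_derivative
          - G n (s - u) - bump a n (w - u)) (at u)"
        using DERIV_diff[OF DERIV_affine[OF deriv, of s "- 1" u] DERIV_affine[OF bump', of t "- 1" u]]
        by (simp add: w_def diff_diff_eq add.commute)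
      moreover have "bump a n (w - u) = bump a n (\<bar>w\<bar> + u)"
        using bump_even[OF a, of n "w - u"] 3 by (simp add: algebra_simps)
      ultimately show "\<exists>y. ((\<lambda>u. G (Suc n) (s - u) - bump a (Suc n) (t - u)) has_real_derivative y) (at u) \<and> 0 \<le> y"
        using descent(2)[of u] u 3
        by (intro exI[of _ "- G n (s - u) - bump a n (w - u)"] conjI) (auto simp: v_def)
    qed (use 3 in \<open>auto simp: v_def\<close>)
    moreover have "t - v = c - ?z" by (simp add: v_def w_def)
    ultimately have "?B \<le> G (Suc n) (s - v)"
      using plateau(1)[of n ?z] c_foot_bounds(3)[of n] eq by simp
    then show False using below[of "s - v"] by simp
  qed
qed

text \<open>
  The other sign follows by symmetry: negate the chain and reflect the spline at its zero \<open>c\<close>.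
\<close>

lemma comparison:
  assumes "slow_descent n" "\<mu> < 1" and G: "spline_class a \<mu> (Suc n) G"
    and t: "0 \<le> t" "t \<le> 2 * c" and eq: "G (Suc n) s = bump a (Suc n) t"
  shows "\<bar>G n s\<bar> < bump a n (t - c)"
proof -
  have "- bump a n (2 * c - t - c) < - G n s"
    by (rule comparison_one_sided[OF assms(1,2) spline_class_uminus[OF G]])
       (use t eq bump_reflect[OF a, of "Suc n" t] in \<open>auto simp: c_def\<close>)
  moreover have "bump a n (2 * c - t - c) = bump a n (t - c)"
    using bump_even[OF a, of n "t - c"] by (simp add: algebra_simps)
  ultimately show ?thesis
    using comparison_one_sided[OF assms] by simp
qed

lemma slow_descent_Suc:
  assumes D: "slow_descent n"
  shows "slow_descent (Suc n)"
  unfolding slow_descent_def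
proof (intro allI impI)
  fix \<mu> s t u :: real and G
  assume mu: "\<mu> < 1" and G: "spline_class a \<mu> (Suc n) G" and ge: "bump a (Suc n) t \<le> G (Suc n) s"
    and t: "0 \<le> t" "0 \<le> u" "t + u \<le> foot a (Suc n)"
  then have le: "t + u \<le> c" by (simp add: foot_def c_def)
  have deriv: "(G (Suc n) has_real_derivative G n t) (at t)" for t
    using G by (simp add: spline_class_def)
  have bump': "(bump a (Suc n) has_real_derivative - bump a n (t - c)) (at t)" for t
    using bump_deriv[OF a] by (simp add: c_def)
  have *: "0 \<le> G (Suc n) (s + e * u) - bump a (Suc n) (t + u)" if "\<bar>e\<bar> = 1" for e
  proof (rule nonneg_barrier[where U = u and f = "\<lambda>v. G (Suc n) (s + e * v) - bump a (Suc n) (t + v)"])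
    fix v assume v: "0 \<le> v" "v \<le> u"
    show "((\<lambda>v. G (Suc n) (s + e * v) - bump a (Suc n) (t + v)) has_real_derivative
        e * G n (s + e * v) + bump a n (t + v - c)) (at v)"
      using DERIV_diff[OF DERIV_affine[OF deriv, of s e v] DERIV_affine[OF bump', of t 1 v]] by simp
    assume "G (Suc n) (s + e * v) - bump a (Suc n) (t + v) = 0"
    then have "\<bar>G n (s + e * v)\<bar> < bump a n (t + v - c)"
      using v t le c_foot_bounds(1) by (intro comparison[OF D mu G]) auto
    moreover have "\<bar>e * G n (s + e * v)\<bar> = \<bar>G n (s + e * v)\<bar>" using that by (simp add: abs_mult)
    ultimately show "0 < e * G n (s + e * v) + bump a n (t + v - c)" by linarith
  qed (use ge t in auto)
  show "bump a (Suc n) (t + u) \<le> G (Suc n) (s + u) \<and> bump a (Suc n) (t + u) \<le> G (Suc n) (s - u)"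
    using *[of 1] *[of "- 1"] by simp
qed

lemma slow_descent: "slow_descent n"
  by (induction n) (rule slow_descent_0, rule slow_descent_Suc)

theorem spline_class_mono:
  assumes "spline_class a \<mu> n G" "j \<le> n"
  shows "spline_class a \<mu> j G"
  using assms(2,1)
  by (induction rule: inc_induct) (auto intro: spline_class_derivative[OF slow_descent])

end

section \<open>Absolutely continuous functions are differentiable almost everywhere\<close>

text \<open>
  A function of intervals given as sets, as these are the members of a \<open>division_of\<close>.
\<close>

definition increment :: "(real \<Rightarrow> real) \<Rightarrow> real set \<Rightarrow> real" where
  "increment F K = F (Sup K) - F (Inf K)"

lemma increment_interval: "u \<le> v \<Longrightarrow> increment F {u..v} = F v - F u"
  by (simp add: increment_def)

lemma division_real_memE:
  assumes "p division_of S" "K \<in> p"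
  obtains u v :: real where "u \<le> v" "K = {u..v}"
proof -
  from division_ofD(3,4)[OF assms] obtain u v where "K = {u..v}" "K \<noteq> {}" by auto
  then show ?thesis using that[of u v] by auto
qed

lemma increment_division:
  assumes "p division_of {c..d}" "c \<le> d"
  shows "(\<Sum>K\<in>p. increment F K) = F d - F c"
proof -
  let ?f = "\<lambda>K::real set. if K = {} then 0 else increment F K"
  interpret operative_real plus 0 ?f
    rewrites "comm_monoid_set.F (+) 0 = sum"
    by standard[1] (auto simp: sum_def increment_def)
  have "(\<Sum>K\<in>p. increment F K) = (\<Sum>K\<in>p. ?f K)"
    using division_ofD(3)[OF assms(1)] by (intro sum.cong) auto
  also have "\<dots> = ?f {c..d}"
    using division[of p c d] assms by simp
  finally show ?thesis using assms(2) by (simp add: increment_def)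
qed

lemma increment_id_division:
  assumes "p division_of S"
  shows "(\<Sum>K\<in>p. increment (\<lambda>t. t) K) = measure lebesgue S"
proof -
  have "(\<Sum>K\<in>p. increment (\<lambda>t. t) K) = (\<Sum>K\<in>p. measure lebesgue K)"
    by (rule sum.cong) (auto simp: increment_def elim!: division_real_memE[OF assms])
  then show ?thesis using content_division[OF assms] by simp
qed

text \<open>
  What the intervals of \<open>J\<close> leave uncovered in those of \<open>I\<close> is again a finite union of intervals, and
  increments are additive. The family \<open>R\<close> does not depend on \<open>F\<close>, so the identity applied to
  \<open>\<lambda>t. t\<close> gives the total length of \<open>R\<close>.
\<close>

lemma nested_division_complement:
  fixes I J :: "real set set"
  assumes I: "I division_of \<Union>I" "\<Union>I \<subseteq> {c..d}" and J: "J division_of \<Union>J" "\<Union>J \<subseteq> \<Union>I"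
    and "c \<le> d"
  obtains R where "R division_of \<Union>R" "\<Union>R \<subseteq> {c..d}"
    "\<And>F. (\<Sum>K\<in>R. increment F K) = (\<Sum>K\<in>I. increment F K) - (\<Sum>K\<in>J. increment F K)"
proof -
  obtain q where q: "I \<subseteq> q" "q division_of {c..d}"
    using partial_division_extend_interval[of I c d] I by auto
  define I' where "I' = q - I"
  have fin: "finite q" "finite J" using q J by auto
  have I': "I' division_of \<Union>I'"
    by (rule division_of_subset[OF division_of_union_self[OF q(2)]]) (auto simp: I'_def)
  have disj: "interior (\<Union>J) \<inter> interior (\<Union>I') = {}"
  proof -
    have "interior (\<Union>I) \<inter> interior (\<Union>I') = {}"
    proof (rule Int_interior_Union_intervals)
      show "\<exists>a b. T = cbox a b" if "T \<in> I'" for T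
        using division_ofD(4)[OF I' that] .
      show "finite I'" using division_ofD(1)[OF I'] .
      fix T assume "T \<in> I'"
      then have "interior T \<inter> interior K = {}" if "K \<in> I" for K
        using division_ofD(5)[OF q(2), of T K] q(1) that by (auto simp: I'_def)
      moreover have "open (interior T)" "finite I" "\<And>K. K \<in> I \<Longrightarrow> \<exists>a b. K = cbox a b"
        using division_ofD(1,4)[OF I(1)] by auto
      ultimately have "interior T \<inter> interior (\<Union>I) = {}"
        by (intro Int_interior_Union_intervals) auto
      then show "interior (\<Union>I) \<inter> interior T = {}" by auto
    qed simp
    then show ?thesis using interior_mono[OF J(2)] by blast
  qed
  have JI': "(J \<union> I') division_of \<Union>(J \<union> I')"
    using division_disjoint_union[OF J(1) I' disj] by simp
  have "\<Union>(J \<union> I') \<subseteq> cbox c d"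
    using J(2) I(2) division_ofD(6)[OF q(2)] by (auto simp: I'_def)
  then obtain q' where q': "J \<union> I' \<subseteq> q'" "q' division_of {c..d}"
    using partial_division_extend_interval[OF JI'] by auto
  define R where "R = q' - (J \<union> I')"
  show ?thesis
  proof
    show "R division_of \<Union>R"
      by (rule division_of_subset[OF division_of_union_self[OF q'(2)]]) (auto simp: R_def)
    show "\<Union>R \<subseteq> {c..d}"
      using division_ofD(2)[OF q'(2)] by (auto simp: R_def)
    fix F
    let ?g = "increment F"
    have "(\<Sum>K\<in>q'. ?g K) = (\<Sum>K\<in>R. ?g K) + (\<Sum>K\<in>J \<union> I'. ?g K)"
      unfolding R_def using q' by (intro sum.subset_diff) auto
    moreover have "(\<Sum>K\<in>J \<union> I'. ?g K) = (\<Sum>K\<in>J. ?g K) + (\<Sum>K\<in>I'. ?g K)"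
    proof -
      \<comment> \<open>Only a degenerate interval can belong to both families.\<close>
      have "?g K = 0" if K: "K \<in> J \<inter> I'" for K
      proof -
        have "interior K \<subseteq> interior (\<Union>J)" "interior K \<subseteq> interior (\<Union>I')"
          using K by (auto intro: interior_mono[THEN subsetD])
        then have "interior K = {}" using disj by blast
        moreover obtain u v where "u \<le> v" "K = {u..v}"
          using division_real_memE[OF J(1)] K by blast
        ultimately show ?thesis by (auto simp: increment_def)
      qed
      then have "(\<Sum>K\<in>J \<inter> I'. ?g K) = 0" by simp
      then show ?thesis
        using sum.union_inter[of J I' ?g] fin by (auto simp: I'_def)
    qed
    moreover have "(\<Sum>K\<in>q. ?g K) = (\<Sum>K\<in>I'. ?g K) + (\<Sum>K\<in>I. ?g K)"
      unfolding I'_def using q fin by (intro sum.subset_diff) auto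
    moreover have "(\<Sum>K\<in>q. ?g K) = (\<Sum>K\<in>q'. ?g K)"
      using increment_division[OF q(2) \<open>c \<le> d\<close>] increment_division[OF q'(2) \<open>c \<le> d\<close>] by simp
    ultimately show "(\<Sum>K\<in>R. ?g K) = (\<Sum>K\<in>I. ?g K) - (\<Sum>K\<in>J. ?g K)"
      by simp
  qed
qed

lemma abs_continuous_on_intervalE:
  assumes "abs_continuous_on_interval c d F" "\<epsilon> > 0"
  obtains \<delta> where "\<delta> > 0" "\<And>n u v. \<lbrakk>\<forall>i<n. c \<le> u i \<and> u i \<le> v i \<and> v i \<le> d;
      disjoint_family_on (\<lambda>i. {u i<..<v i}) {..<n}; (\<Sum>i<n. v i - u i) < \<delta>\<rbrakk>
      \<Longrightarrow> (\<Sum>i<n::nat. \<bar>F (v i) - F (u i)\<bar>) < \<epsilon>"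
proof -
  from assms(1)[unfolded abs_continuous_on_interval_def, rule_format, OF assms(2)]
  obtain \<delta> where \<delta>: "\<delta> > 0" "\<forall>n::nat. \<forall>u v. (\<forall>i<n. c \<le> u i \<and> u i \<le> v i \<and> v i \<le> d) \<longrightarrow>
      disjoint_family_on (\<lambda>i. {u i<..<v i}) {..<n} \<longrightarrow> (\<Sum>i<n. v i - u i) < \<delta> \<longrightarrow>
      (\<Sum>i<n. \<bar>F (v i) - F (u i)\<bar>) < \<epsilon>"
    by (elim exE conjE)
  show ?thesis
    by (rule that[OF \<delta>(1)], rule \<delta>(2)[THEN spec, THEN spec, THEN spec, THEN mp, THEN mp, THEN mp])
qed

lemma abs_continuous_small_division:
  assumes "abs_continuous_on_interval c d F" "\<epsilon> > 0"
  obtains \<delta> where "\<delta> > 0"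
    "\<And>p. p division_of \<Union>p \<Longrightarrow> \<Union>p \<subseteq> {c..d} \<Longrightarrow> measure lebesgue (\<Union>p) < \<delta> \<Longrightarrow>
       \<bar>\<Sum>K\<in>p. increment F K\<bar> < \<epsilon>"
proof -
  obtain \<delta> where \<delta>: "\<delta> > 0" and ac: "\<And>n u v. \<lbrakk>\<forall>i<n. c \<le> u i \<and> u i \<le> v i \<and> v i \<le> d;
      disjoint_family_on (\<lambda>i. {u i<..<v i}) {..<n}; (\<Sum>i<n. v i - u i) < \<delta>\<rbrakk>
      \<Longrightarrow> (\<Sum>i<n::nat. \<bar>F (v i) - F (u i)\<bar>) < \<epsilon>"
    using abs_continuous_on_intervalE[OF assms] by blast
  have "\<bar>\<Sum>K\<in>p. increment F K\<bar> < \<epsilon>"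
    if p: "p division_of \<Union>p" "\<Union>p \<subseteq> {c..d}" "measure lebesgue (\<Union>p) < \<delta>" for p
  proof -
    obtain h where h: "bij_betw h {..<card p} p"
      using ex_bij_betw_nat_finite[of p] p by (auto simp: atLeast0LessThan)
    define u v where "u i = Inf (h i)" and "v i = Sup (h i)" for i
    have hK: "h i = {u i..v i} \<and> u i \<le> v i \<and> h i \<in> p" if "i < card p" for i
    proof -
      have "h i \<in> p" using h that by (auto simp: bij_betw_def)
      then obtain x y where "x \<le> y" "h i = {x..y}"
        using division_real_memE[OF p(1)] by blast
      then show ?thesis using \<open>h i \<in> p\<close> by (simp add: u_def v_def)
    qed
    have "(\<Sum>i<card p. \<bar>F (v i) - F (u i)\<bar>) < \<epsilon>"
    proof (rule ac)
      show "\<forall>i<card p. c \<le> u i \<and> u i \<le> v i \<and> v i \<le> d"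
        using hK p(2) by fastforce
      show "disjoint_family_on (\<lambda>i. {u i<..<v i}) {..<card p}"
        unfolding disjoint_family_on_def
      proof (intro ballI impI)
        fix i j assume ij: "i \<in> {..<card p}" "j \<in> {..<card p}" "i \<noteq> j"
        then have "h i \<noteq> h j" using h by (auto simp: bij_betw_def inj_on_def)
        then have "interior (h i) \<inter> interior (h j) = {}"
          using division_ofD(5)[OF p(1), of "h i" "h j"] hK ij by blast
        moreover have "{u i<..<v i} = interior (h i)" "{u j<..<v j} = interior (h j)"
          using hK ij by auto
        ultimately show "{u i<..<v i} \<inter> {u j<..<v j} = {}" by simp
      qed
      have "(\<Sum>i<card p. v i - u i) = (\<Sum>K\<in>p. increment (\<lambda>t. t) K)"
        using sum.reindex_bij_betw[OF h, of "increment (\<lambda>t. t)"] by (simp add: increment_def u_def v_def)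
      then show "(\<Sum>i<card p. v i - u i) < \<delta>"
        using increment_id_division[OF p(1)] p(3) by simp
    qed
    moreover have "(\<Sum>K\<in>p. increment F K) = (\<Sum>i<card p. F (v i) - F (u i))"
      using sum.reindex_bij_betw[OF h, of "increment F"] by (simp add: increment_def u_def v_def)
    ultimately show ?thesis using sum_abs[of "\<lambda>i. F (v i) - F (u i)" "{..<card p}"] by linarith
  qed
  with \<delta> that show ?thesis by blast
qed

text \<open>
  The form in which absolute continuity is used below: increments over two nested families nearly agree
  when one nearly exhausts the other.
\<close>

lemma abs_continuous_nested_divisions:
  assumes "abs_continuous_on_interval c d F" "\<epsilon> > 0" "c \<le> d"
  obtains \<delta> where "\<delta> > 0"
    "\<And>I J. I division_of \<Union>I \<Longrightarrow> \<Union>I \<subseteq> {c..d} \<Longrightarrow> J division_of \<Union>J \<Longrightarrow> \<Union>J \<subseteq> \<Union>I \<Longrightarrow>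
       measure lebesgue (\<Union>I) < measure lebesgue (\<Union>J) + \<delta> \<Longrightarrow>
       \<bar>(\<Sum>K\<in>I. increment F K) - (\<Sum>K\<in>J. increment F K)\<bar> < \<epsilon>"
proof -
  obtain \<delta> where \<delta>: "\<delta> > 0"
    "\<And>p. p division_of \<Union>p \<Longrightarrow> \<Union>p \<subseteq> {c..d} \<Longrightarrow> measure lebesgue (\<Union>p) < \<delta> \<Longrightarrow>
       \<bar>\<Sum>K\<in>p. increment F K\<bar> < \<epsilon>"
    using abs_continuous_small_division[OF assms(1,2)] by blast
  have "\<bar>(\<Sum>K\<in>I. increment F K) - (\<Sum>K\<in>J. increment F K)\<bar> < \<epsilon>"
    if IJ: "I division_of \<Union>I" "\<Union>I \<subseteq> {c..d}" "J division_of \<Union>J" "\<Union>J \<subseteq> \<Union>I"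
      "measure lebesgue (\<Union>I) < measure lebesgue (\<Union>J) + \<delta>" for I J
  proof -
    obtain R where R: "R division_of \<Union>R" "\<Union>R \<subseteq> {c..d}"
      "\<And>F. (\<Sum>K\<in>R. increment F K) = (\<Sum>K\<in>I. increment F K) - (\<Sum>K\<in>J. increment F K)"
      using nested_division_complement[OF IJ(1-4) assms(3)] by blast
    have "measure lebesgue (\<Union>R) < \<delta>"
      using R(3)[of "\<lambda>t. t"] IJ(5)
      unfolding increment_id_division[OF R(1)] increment_id_division[OF IJ(1)]
        increment_id_division[OF IJ(3)] by simp
    then show ?thesis using \<delta>(2)[OF R(1,2)] R(3) by simp
  qed
  with \<delta>(1) that show ?thesis by blast
qed

text \<open>
  The Vitali covering theorem covers \<open>E\<close> up to a null set by disjoint intervals of a given kind. Finitely many of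
  them already cover \<open>E\<close> up to measure \<open>\<epsilon>\<close>.
\<close>

lemma Vitali_division:
  fixes E U :: "real set"
  assumes E: "E \<in> lmeasurable" and U: "open U" "E \<subseteq> U" and "\<epsilon> > 0"
    and fine: "\<And>t e. t \<in> E \<Longrightarrow> e > 0 \<Longrightarrow> \<exists>u v. u < t \<and> t < v \<and> v - u < e \<and> R u v"
  obtains p where "p division_of \<Union>p" "\<Union>p \<subseteq> U"
    "\<And>K. K \<in> p \<Longrightarrow> \<exists>u v. u < v \<and> K = {u..v} \<and> R u v" "measure lebesgue (E - \<Union>p) < \<epsilon>"
proof -
  define V where "V = {(u, v). u < v \<and> {u..v} \<subseteq> U \<and> R u v}"
  define a r where "a i = (fst i + snd i) / 2" and "r i = (snd i - fst i) / 2" for i :: "real \<times> real"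
  have cball: "cball (a i) (r i) = {fst i..snd i}" for i
    by (simp add: cball_eq_atLeastAtMost a_def r_def field_simps)
  have r: "0 < r i" if "i \<in> V" for i
    using that by (auto simp: V_def r_def)
  have ex: "\<exists>i. i \<in> V \<and> t \<in> cball (a i) (r i) \<and> r i < e" if "t \<in> E" "0 < e" for t e
  proof -
    from U that obtain e' where e': "e' > 0" "ball t e' \<subseteq> U"
      by (meson openE subsetD)
    from e' \<open>0 < e\<close> have "min e e' > 0" by simp
    then obtain u v where uv: "u < t" "t < v" "v - u < min e e'" "R u v"
      using fine[OF \<open>t \<in> E\<close>] by blast
    have "{u..v} \<subseteq> ball t e'" using uv by (auto simp: dist_real_def)
    then have "(u, v) \<in> V" using e' uv by (auto simp: V_def)
    moreover have "r (u, v) < e" using uv by (simp add: r_def)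
    ultimately show ?thesis using uv unfolding cball by (intro exI[of _ "(u, v)"]) auto
  qed
  obtain C where C: "countable C" "C \<subseteq> V"
    "pairwise (\<lambda>i j. disjnt (cball (a i) (r i)) (cball (a j) (r j))) C"
    "negligible (E - (\<Union>i\<in>C. cball (a i) (r i)))"
    using Vitali_covering_theorem_cballs[of V r E a] r ex by blast
  let ?D = "(\<lambda>i. E \<inter> {fst i..snd i}) ` C"
  have mono: "measure lebesgue S \<le> measure lebesgue E" if "S \<subseteq> E" "S \<in> lmeasurable" for S
    using that E by (intro measure_mono_fmeasurable) auto
  obtain D' where D': "D' \<subseteq> ?D" "finite D'"
    "measure lebesgue (\<Union>?D) - \<epsilon> < measure lebesgue (\<Union>D')"
  proof (rule measure_countable_Union_approachable[of ?D \<epsilon> "measure lebesgue E"])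
    show "d \<in> lmeasurable" if "d \<in> ?D" for d
      using that E by auto
    show "measure lebesgue (\<Union>D') \<le> measure lebesgue E" if "D' \<subseteq> ?D" "finite D'" for D'
      using that E by (intro mono fmeasurable.finite_Union) auto
  qed (use C \<open>\<epsilon> > 0\<close> in auto)
  obtain C' where C': "C' \<subseteq> C" "finite C'" "D' = (\<lambda>i. E \<inter> {fst i..snd i}) ` C'"
    using finite_subset_image[OF D'(2,1)] by blast
  define p where "p = (\<lambda>i. {fst i..snd i}) ` C'"
  have V: "fst i < snd i \<and> {fst i..snd i} \<subseteq> U \<and> R (fst i) (snd i)" if "i \<in> C'" for i
    using that C'(1) C(2) unfolding V_def by force
  show ?thesis
  proof
    show "p division_of \<Union>p"
    proof (rule division_ofI)
      fix K1 K2 assume "K1 \<in> p" "K2 \<in> p" "K1 \<noteq> K2"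
      then obtain i j where ij: "i \<in> C'" "j \<in> C'" "i \<noteq> j" "K1 = {fst i..snd i}" "K2 = {fst j..snd j}"
        unfolding p_def by auto
      then have "disjnt K1 K2"
        using C(3)[unfolded pairwise_def cball, rule_format, of i j] C'(1) by auto
      then show "interior K1 \<inter> interior K2 = {}"
        using interior_subset[of K1] interior_subset[of K2] unfolding disjnt_def by blast
    next
      fix K assume "K \<in> p"
      then obtain i where i: "i \<in> C'" "K = {fst i..snd i}" by (auto simp: p_def)
      then show "K \<noteq> {}" "\<exists>a b. K = cbox a b" using V[OF i(1)] by auto
    qed (use C' in \<open>auto simp: p_def\<close>)
    show "\<Union>p \<subseteq> U" using V by (auto simp: p_def)
    show "\<exists>u v. u < v \<and> K = {u..v} \<and> R u v" if "K \<in> p" for K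
      using that V by (auto simp: p_def)
    let ?C = "\<Union>i\<in>C. cball (a i) (r i)"
    have meas: "\<Union>p \<in> lmeasurable" "\<Union>?D \<in> lmeasurable"
    proof -
      show "\<Union>p \<in> lmeasurable" using C' by (auto simp: p_def intro!: fmeasurable.finite_Union)
      have "\<Union>?D \<in> sets lebesgue" using C(1) E by (intro sets.countable_Union) auto
      then show "\<Union>?D \<in> lmeasurable" using E by (rule fmeasurableI2[rotated 2]) auto
    qed
    have split: "\<Union>?D \<union> (E - ?C) = E" unfolding cball by auto
    have "measure lebesgue (\<Union>?D \<union> (E - ?C)) \<le> measure lebesgue (\<Union>?D) + measure lebesgue (E - ?C)"
      using measure_Un_le[of "\<Union>?D" lebesgue "E - ?C"] meas C(4)
      by (simp add: fmeasurableD negligible_imp_sets)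
    also have "measure lebesgue (E - ?C) = 0"
      using C(4) by (rule negligible_imp_measure0)
    finally have "measure lebesgue E \<le> measure lebesgue (\<Union>?D)" unfolding split by simp
    then have "measure lebesgue E - \<epsilon> < measure lebesgue (\<Union>D')" using D' by simp
    also have "\<Union>D' = E \<inter> \<Union>p" using C'(3) by (auto simp: p_def)
    finally have "measure lebesgue E - \<epsilon> < measure lebesgue (E \<inter> \<Union>p)" .
    moreover have "measure lebesgue (E - \<Union>p) = measure lebesgue E - measure lebesgue (E \<inter> \<Union>p)"
      using measurable_measure_Diff[of E lebesgue "E \<inter> \<Union>p"] E meas(1)
      by (simp add: Diff_Int fmeasurableD)
    ultimately show "measure lebesgue (E - \<Union>p) < \<epsilon>" by simp
  qed
qed

text \<open>
  The points at which the upper derivate, over intervals having the point in their interior, is at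
  least \<open>q\<close> in the sense that slopes above \<open>q\<close> occur at arbitrarily small scales. Requiring interior points
  makes this set a countable intersection of open sets. Slopes below \<open>p\<close> are those of \<open>\<lambda>t. - F t\<close>
  above \<open>- p\<close>.
\<close>

definition steep_points :: "(real \<Rightarrow> real) \<Rightarrow> real \<Rightarrow> real set" where
  "steep_points F q =
     {t. \<forall>e>0. \<exists>u v. u < t \<and> t < v \<and> v - u < e \<and> q * (v - u) < F v - F u}"

lemma steep_points_borel: "steep_points F q \<in> sets borel"
proof -
  define W where "W n = \<Union>{{u<..<v} |u v. v - u < 1 / real (Suc n) \<and> q * (v - u) < F v - F u}" for n
  have "steep_points F q = (\<Inter>n. W n)"
  proof (intro equalityI subsetI)
    fix t assume t: "t \<in> steep_points F q"
    show "t \<in> (\<Inter>n. W n)"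
    proof
      fix n
      have "1 / real (Suc n) > 0" by simp
      then obtain u v where "u < t" "t < v" "v - u < 1 / real (Suc n)" "q * (v - u) < F v - F u"
        using t unfolding steep_points_def by blast
      then show "t \<in> W n" unfolding W_def by (intro UnionI[of "{u<..<v}"]) auto
    qed
  next
    fix t assume t: "t \<in> (\<Inter>n. W n)"
    show "t \<in> steep_points F q"
      unfolding steep_points_def
    proof (intro CollectI allI impI)
      fix e :: real assume "e > 0"
      then obtain n where "1 / real (Suc n) < e" using nat_approx_posE by blast
      moreover from t have "t \<in> W n" by blast
      ultimately show "\<exists>u v. u < t \<and> t < v \<and> v - u < e \<and> q * (v - u) < F v - F u"
        unfolding W_def by fastforce
    qed
  qed
  moreover have "open (W n)" for n
    unfolding W_def by (intro open_Union) auto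
  ultimately show ?thesis by auto
qed

lemma steep_pointsD:
  assumes "t \<in> steep_points F q" "e > 0"
  shows "\<exists>u v. u < t \<and> t < v \<and> v - u < e \<and> q * (v - u) < F v - F u"
  using assms unfolding steep_points_def by blast

lemma steep_division_increment:
  assumes "p division_of \<Union>p" "\<And>K. K \<in> p \<Longrightarrow> \<exists>u v. u < v \<and> K = {u..v} \<and> q * (v - u) < F v - F u"
  shows "q * measure lebesgue (\<Union>p) \<le> (\<Sum>K\<in>p. increment F K)"
proof -
  have "q * increment (\<lambda>t. t) K \<le> increment F K" if "K \<in> p" for K
    using assms(2)[OF that] by (auto simp: increment_interval)
  then have "(\<Sum>K\<in>p. q * increment (\<lambda>t. t) K) \<le> (\<Sum>K\<in>p. increment F K)"
    by (rule sum_mono)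
  then show ?thesis
    using increment_id_division[OF assms(1)] by (simp flip: sum_distrib_left)
qed

lemma increment_uminus: "increment (\<lambda>t. - F t) K = - increment F K"
  by (simp add: increment_def)

lemma lmeasurable_outer_open_within:
  fixes E U :: "real set"
  assumes "E \<in> lmeasurable" "E \<subseteq> U" "open U" "\<epsilon> > 0"
  obtains T where "open T" "E \<subseteq> T" "T \<subseteq> U" "T \<in> lmeasurable" "measure lebesgue T < measure lebesgue E + \<epsilon>"
proof -
  obtain T where T: "open T" "E \<subseteq> T" "T - E \<in> lmeasurable" "emeasure lebesgue (T - E) < ennreal \<epsilon>"
    using sets_lebesgue_outer_open[of E \<epsilon>] assms by blast
  have TE: "T = E \<union> (T - E)" using T by auto
  then have Tm: "T \<in> lmeasurable" using T(3) assms(1) by (metis fmeasurable.Un)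
  have "measure lebesgue (T - E) < \<epsilon>"
    using T(3,4) assms(4) by (simp add: emeasure_eq_measure2 ennreal_less_iff)
  moreover have "measure lebesgue (T \<inter> U) \<le> measure lebesgue T"
    using Tm assms(3) by (intro measure_mono_fmeasurable) auto
  moreover have "measure lebesgue T \<le> measure lebesgue E + measure lebesgue (T - E)"
    using measure_Un_le[of E lebesgue "T - E"] T(3) assms(1) TE by (metis fmeasurableD)
  moreover have "T \<inter> U \<in> lmeasurable"
    using Tm assms(3) by (intro fmeasurable_Int_fmeasurable) auto
  ultimately show ?thesis
    using that[of "T \<inter> U"] T assms by auto
qed

lemma nonpos_if_le_small_multiples:
  fixes x C :: real
  assumes "\<And>\<epsilon>. \<epsilon> > 0 \<Longrightarrow> x \<le> \<epsilon> * C" "C > 0"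
  shows "x \<le> 0"
proof -
  have "x / C \<le> \<epsilon>" if "\<epsilon> > 0" for \<epsilon>
    using assms that by (simp add: divide_le_eq)
  then have "x / C \<le> 0" by (meson dense_ge)
  then show ?thesis using assms(2) by (simp add: divide_le_0_iff)
qed

text \<open>
  Let \<open>E\<close> be the bounded part of the set. Choose disjoint intervals \<open>I\<close> of slope below \<open>p\<close> in an open set
  barely larger than \<open>E\<close>, and then disjoint intervals \<open>J\<close> of slope above \<open>q\<close> in the interior of their union,
  both covering nearly all of \<open>E\<close>. As \<open>I\<close> and \<open>J\<close> nearly have the same measure, absolute continuity makes
  the two increments nearly equal, so up to small errors \<open>q\<close> times the measure of \<open>E\<close> is at most \<open>p\<close> times
  this measure.
\<close>

lemma negligible_oscillating_slopes:
  assumes F: "locally_abs_continuous F" and "p < q"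
  shows "negligible (steep_points F q \<inter> steep_points (\<lambda>t. - F t) (- p))"
proof (rule negligible_on_intervals[THEN iffD2], intro allI)
  fix c d :: real
  define E where "E = (steep_points F q \<inter> steep_points (\<lambda>t. - F t) (- p)) \<inter> cbox c d"
  have E: "E \<in> lmeasurable"
    unfolding E_def using steep_points_borel
    by (intro fmeasurable_Int_fmeasurable[OF lmeasurable_cbox, folded Int_commute]) auto
  show "negligible (steep_points F q \<inter> steep_points (\<lambda>t. - F t) (- p) \<inter> cbox c d)"
  proof (cases "c \<le> d")
    case False
    then have "cbox c d = {}" by simp
    then show ?thesis by (simp only: Int_empty_right negligible_empty)
  next
    case True
    let ?m = "measure lebesgue"
    have ac: "abs_continuous_on_interval (c - 1) (d + 1) F"
      using F[unfolded locally_abs_continuous_def, rule_format, of "c - 1" "d + 1"] True by linarith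
    have cd: "c - 1 \<le> d + 1" using True by simp
    have down: "\<exists>u v. u < t \<and> t < v \<and> v - u < e \<and> - p * (v - u) < - F v - (- F u)"
      if "t \<in> E" "e > 0" for t e
      using that by (intro steep_pointsD[where F = "\<lambda>t. - F t"]) (simp_all add: E_def)
    have up: "\<exists>u v. u < t \<and> t < v \<and> v - u < e \<and> q * (v - u) < F v - F u"
      if "t \<in> E \<inter> V" "e > 0" for t e V
      using that by (intro steep_pointsD) (simp_all add: E_def)
    have "(q - p) * ?m E \<le> \<epsilon> * (1 + 3 * \<bar>q\<bar> + (q - p))" if "\<epsilon> > 0" for \<epsilon>
    proof -
      obtain \<delta> where \<delta>: "\<delta> > 0"
        "\<And>I J. I division_of \<Union>I \<Longrightarrow> \<Union>I \<subseteq> {c - 1..d + 1} \<Longrightarrow> J division_of \<Union>J \<Longrightarrow> \<Union>J \<subseteq> \<Union>I \<Longrightarrow>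
           ?m (\<Union>I) < ?m (\<Union>J) + \<delta> \<Longrightarrow>
           \<bar>(\<Sum>K\<in>I. increment F K) - (\<Sum>K\<in>J. increment F K)\<bar> < \<epsilon>"
        using abs_continuous_nested_divisions[OF ac \<open>\<epsilon> > 0\<close> cd] by blast
      \<comment> \<open>The measures of \<open>I\<close> and \<open>J\<close> will differ by less than \<open>3 * \<eta>\<close>: one \<open>\<eta>\<close> is lost in the open set
        and one in each covering.\<close>
      define \<eta> where "\<eta> = min \<epsilon> (\<delta> / 3)"
      have \<eta>: "0 < \<eta>" "\<eta> \<le> \<epsilon>" "3 * \<eta> \<le> \<delta>" using \<delta> that by (auto simp: \<eta>_def)
      obtain T where T: "open T" "E \<subseteq> T" "T \<subseteq> {c - 1<..<d + 1}" "T \<in> lmeasurable" "?m T < ?m E + \<eta>"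
        by (rule lmeasurable_outer_open_within[OF E, of "{c - 1<..<d + 1}" \<eta>]) (use \<eta> in \<open>auto simp: E_def\<close>)
      obtain I where I: "I division_of \<Union>I" "\<Union>I \<subseteq> T"
        "\<And>K. K \<in> I \<Longrightarrow> \<exists>u v. u < v \<and> K = {u..v} \<and> - p * (v - u) < - F v - (- F u)"
        "?m (E - \<Union>I) < \<eta>"
        using Vitali_division[OF E T(1,2) \<eta>(1), of "\<lambda>u v. - p * (v - u) < - F v - (- F u)", OF down]
        by blast
      have Im: "\<Union>I \<in> lmeasurable" using I(1) by (rule lmeasurable_division)
      have intI: "interior (\<Union>I) \<in> lmeasurable"
        by (rule fmeasurableI2[OF Im interior_subset]) auto
      let ?E' = "E \<inter> interior (\<Union>I)"
      have E': "?E' \<in> lmeasurable" using E by (intro fmeasurable_Int_fmeasurable) auto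
      obtain J where J: "J division_of \<Union>J" "\<Union>J \<subseteq> interior (\<Union>I)"
        "\<And>K. K \<in> J \<Longrightarrow> \<exists>u v. u < v \<and> K = {u..v} \<and> q * (v - u) < F v - F u"
        "?m (?E' - \<Union>J) < \<eta>"
        using Vitali_division[OF E' open_interior Int_lower2 \<eta>(1), of "\<lambda>u v. q * (v - u) < F v - F u", OF up]
        by blast
      have Jm: "\<Union>J \<in> lmeasurable" using J(1) by (rule lmeasurable_division)
      have JI: "\<Union>J \<subseteq> \<Union>I" using J(2) interior_subset by blast
      have front: "negligible (\<Union>I - interior (\<Union>I))"
      proof (rule negligible_subset)
        show "negligible (\<Union>K\<in>I. K - interior K)"
        proof (rule negligible_Union)
          show "finite ((\<lambda>K. K - interior K) ` I)" using I(1) by auto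
          fix N assume "N \<in> (\<lambda>K. K - interior K) ` I"
          then obtain u v where "N = {u..v} - {u<..<v}" "u \<le> v"
            by (auto elim!: division_real_memE[OF I(1)])
          moreover have "{u..v} - {u<..<v} \<subseteq> {u, v}" by auto
          ultimately show "negligible N" by (metis negligible_finite finite.simps negligible_subset)
        qed
        show "\<Union>I - interior (\<Union>I) \<subseteq> (\<Union>K\<in>I. K - interior K)"
          using interior_mono[of _ "\<Union>I"] by blast
      qed
      have "E \<subseteq> \<Union>J \<union> (?E' - \<Union>J) \<union> (E - \<Union>I) \<union> (\<Union>I - interior (\<Union>I))" by auto
      then have "?m E \<le> ?m (\<Union>J \<union> (?E' - \<Union>J) \<union> (E - \<Union>I) \<union> (\<Union>I - interior (\<Union>I)))"
        using E E' Im intI Jm by (intro measure_mono_fmeasurable) (auto intro!: fmeasurable.Un fmeasurable.Diff)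
      also have "\<dots> \<le> ?m (\<Union>J \<union> (?E' - \<Union>J) \<union> (E - \<Union>I)) + ?m (\<Union>I - interior (\<Union>I))"
        using E E' Im intI Jm by (intro measure_Un_le) auto
      also have "\<dots> \<le> ?m (\<Union>J \<union> (?E' - \<Union>J)) + ?m (E - \<Union>I) + ?m (\<Union>I - interior (\<Union>I))"
        using E E' Im intI Jm by (intro add_right_mono measure_Un_le) auto
      also have "\<dots> \<le> ?m (\<Union>J) + ?m (?E' - \<Union>J) + ?m (E - \<Union>I) + ?m (\<Union>I - interior (\<Union>I))"
        using E E' Im intI Jm by (intro add_right_mono measure_Un_le) auto
      also have "?m (\<Union>I - interior (\<Union>I)) = 0" using front by (rule negligible_imp_measure0)
      finally have EJ: "?m E \<le> ?m (\<Union>J) + 2 * \<eta>" using I(4) J(4) by simp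
      have "?m (\<Union>I) \<le> ?m T" using I(2) Im T(4) by (intro measure_mono_fmeasurable) auto
      with EJ T(5) have IJ: "?m (\<Union>I) < ?m (\<Union>J) + 3 * \<eta>" by simp
      have JI': "?m (\<Union>J) \<le> ?m (\<Union>I)" using JI Im Jm by (intro measure_mono_fmeasurable) auto
      have "\<Union>I \<subseteq> {c - 1..d + 1}" using I(2) T(3) by fastforce
      then have "\<bar>(\<Sum>K\<in>I. increment F K) - (\<Sum>K\<in>J. increment F K)\<bar> < \<epsilon>"
        using IJ \<eta> by (intro \<delta>(2) I(1) J(1) JI) auto
      moreover have "- p * ?m (\<Union>I) \<le> - (\<Sum>K\<in>I. increment F K)"
        using steep_division_increment[where F = "\<lambda>t. - F t", OF I(1,3)]
        by (simp add: increment_uminus sum_negf)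
      moreover have "q * ?m (\<Union>J) \<le> (\<Sum>K\<in>J. increment F K)"
        using steep_division_increment[OF J(1,3)] by simp
      ultimately have "q * ?m (\<Union>J) - p * ?m (\<Union>I) \<le> \<epsilon>" by linarith
      moreover have "q * (?m (\<Union>I) - ?m (\<Union>J)) \<le> \<bar>q\<bar> * (3 * \<eta>)"
        using IJ JI' by (intro order_trans[OF abs_ge_self, of "q * _"]) (auto simp: abs_mult intro!: mult_left_mono)
      ultimately have "(q - p) * ?m (\<Union>I) \<le> \<epsilon> + \<bar>q\<bar> * (3 * \<eta>)" by (simp add: algebra_simps)
      moreover have "?m E \<le> ?m (\<Union>I) + \<eta>"
      proof -
        have "?m E \<le> ?m (\<Union>I \<union> (E - \<Union>I))"
          using E Im by (intro measure_mono_fmeasurable) (auto intro!: fmeasurable.Un fmeasurable.Diff)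
        also have "\<dots> \<le> ?m (\<Union>I) + ?m (E - \<Union>I)" using E Im by (intro measure_Un_le) auto
        finally show ?thesis using I(4) by simp
      qed
      then have "(q - p) * ?m E \<le> (q - p) * (?m (\<Union>I) + \<eta>)"
        using \<open>p < q\<close> by (intro mult_left_mono) auto
      ultimately have "(q - p) * ?m E \<le> \<epsilon> + \<bar>q\<bar> * (3 * \<eta>) + (q - p) * \<eta>"
        by (simp add: algebra_simps)
      also have "\<dots> \<le> \<epsilon> + \<bar>q\<bar> * (3 * \<epsilon>) + (q - p) * \<epsilon>"
        using \<eta> \<open>p < q\<close> by (intro add_mono mult_left_mono) auto
      finally show ?thesis by (simp add: algebra_simps)
    qed
    moreover have "1 + 3 * \<bar>q\<bar> + (q - p) > 0"
      using \<open>p < q\<close> by (simp add: add_pos_nonneg add_pos_pos)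
    ultimately have "(q - p) * ?m E \<le> 0"
      by (rule nonpos_if_le_small_multiples)
    then have "?m E \<le> 0" using \<open>p < q\<close> by (simp add: mult_le_0_iff)
    then have "?m E = 0" by (simp add: measure_le_0_iff)
    then show ?thesis using E negligible_iff_measure unfolding E_def by blast
  qed
qed

text \<open>
  In an interval of length less than \<open>\<delta>\<close>, total increments are below \<open>1\<close>. If a part of the set of
  positive measure lay in it, intervals of slope \<open>n\<close> covering half of that part would have increments tending to
  infinity with \<open>n\<close>.
\<close>

lemma negligible_infinite_slope:
  assumes F: "locally_abs_continuous F"
  shows "negligible (\<Inter>n::nat. steep_points F (real n))"
proof (rule negligible_on_intervals[THEN iffD2], intro allI)
  fix c d :: real
  let ?S = "(\<Inter>n::nat. steep_points F (real n)) \<inter> cbox c d" and ?m = "measure lebesgue"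
  show "negligible ?S"
  proof (cases "c \<le> d")
    case False
    then have "cbox c d = {}" by simp
    then show ?thesis by (simp only: Int_empty_right negligible_empty)
  next
    case True
    have ac: "abs_continuous_on_interval (c - 1) (d + 1) F"
      using F[unfolded locally_abs_continuous_def, rule_format, of "c - 1" "d + 1"] True by linarith
    obtain \<delta> where \<delta>: "\<delta> > 0"
      "\<And>p. p division_of \<Union>p \<Longrightarrow> \<Union>p \<subseteq> {c - 1..d + 1} \<Longrightarrow> ?m (\<Union>p) < \<delta> \<Longrightarrow>
         \<bar>\<Sum>K\<in>p. increment F K\<bar> < 1"
      by (rule abs_continuous_small_division[OF ac zero_less_one]) blast
    define h where "h = min 1 (\<delta> / 3)"
    have h: "0 < h" "h \<le> 1" "2 * h < \<delta>" using \<delta> by (auto simp: h_def min_def)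
    have "negligible (?S \<inter> {t - h<..<t + h})" if t: "t \<in> ?S" for t
    proof -
      define E where "E = ?S \<inter> {t - h<..<t + h}"
      have "{t - h<..<t + h} \<in> lmeasurable" by simp
      then have E: "E \<in> lmeasurable"
        unfolding E_def using steep_points_borel
        by (intro fmeasurable_Int_fmeasurable[of "{t - h<..<t + h}", folded Int_commute]) auto
      have "?m E = 0"
      proof (rule ccontr)
        assume "?m E \<noteq> 0"
        then have m: "?m E > 0" by (simp add: zero_less_measure_iff)
        obtain n :: nat where n: "real n > 2 / ?m E" using reals_Archimedean2 by blast
        have steep: "\<exists>u v. u < s \<and> s < v \<and> v - u < e \<and> real n * (v - u) < F v - F u"
          if "s \<in> E" "e > 0" for s e
          using that by (intro steep_pointsD) (auto simp: E_def)
        have inside: "open {t - h<..<t + h}" "E \<subseteq> {t - h<..<t + h}" "?m E / 2 > 0"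
          using m by (auto simp: E_def)
        obtain p where p: "p division_of \<Union>p" "\<Union>p \<subseteq> {t - h<..<t + h}"
          "\<And>K. K \<in> p \<Longrightarrow> \<exists>u v. u < v \<and> K = {u..v} \<and> real n * (v - u) < F v - F u"
          "?m (E - \<Union>p) < ?m E / 2"
          using Vitali_division[OF E inside, of "\<lambda>u v. real n * (v - u) < F v - F u"] steep by blast
        have pm: "\<Union>p \<in> lmeasurable" using p(1) by (rule lmeasurable_division)
        have "?m E \<le> ?m (\<Union>p \<union> (E - \<Union>p))"
          using E pm by (intro measure_mono_fmeasurable) (auto intro!: fmeasurable.Un fmeasurable.Diff)
        also have "\<dots> \<le> ?m (\<Union>p) + ?m (E - \<Union>p)" using E pm by (intro measure_Un_le) auto
        finally have big: "?m (\<Union>p) > ?m E / 2" using p(4) by simp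
        have "?m (\<Union>p) \<le> ?m {t - h<..<t + h}"
          using p(2) pm by (intro measure_mono_fmeasurable) auto
        then have "?m (\<Union>p) < \<delta>" using h by simp
        moreover have "\<Union>p \<subseteq> {c - 1..d + 1}" using p(2) t h by fastforce
        ultimately have "(\<Sum>K\<in>p. increment F K) < 1" using \<delta>(2)[OF p(1)] by fastforce
        moreover have "real n * ?m (\<Union>p) \<le> (\<Sum>K\<in>p. increment F K)"
          using steep_division_increment[OF p(1,3)] by simp
        moreover have "real n * ?m (\<Union>p) \<ge> (2 / ?m E) * (?m E / 2)"
          using n big m by (intro mult_mono) auto
        ultimately show False using m by simp
      qed
      then show ?thesis using E negligible_iff_measure unfolding E_def by blast
    qed
    moreover have "openin (top_of_set ?S) (?S \<inter> {t - h<..<t + h})" for t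
      by (intro openin_open_Int) simp
    moreover have "t \<in> ?S \<inter> {t - h<..<t + h}" if "t \<in> ?S" for t
      using that h by simp
    ultimately show ?thesis
      by (intro locally_negligible_alt[THEN iffD2] ballI) blast
  qed
qed

definition around :: "real \<Rightarrow> (real \<Rightarrow> real \<Rightarrow> bool) \<Rightarrow> bool" where
  "around t P \<longleftrightarrow> (\<exists>e>0. \<forall>u v. u < t \<longrightarrow> t < v \<longrightarrow> v - u < e \<longrightarrow> P u v)"

lemma around_mono:
  assumes "around t P" "\<And>u v. u < v \<Longrightarrow> P u v \<Longrightarrow> Q u v"
  shows "around t Q"
proof -
  from assms(1)[unfolded around_def]
  obtain e where e: "e > 0 \<and> (\<forall>u v. u < t \<longrightarrow> t < v \<longrightarrow> v - u < e \<longrightarrow> P u v)" ..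
  show ?thesis unfolding around_def
    by (intro exI[of _ e] conjI allI impI assms(2)) (use e in auto)
qed

lemma around_conj:
  assumes "around t P" "around t Q"
  shows "around t (\<lambda>u v. P u v \<and> Q u v)"
proof -
  from assms(1)[unfolded around_def]
  obtain e where e: "e > 0 \<and> (\<forall>u v. u < t \<longrightarrow> t < v \<longrightarrow> v - u < e \<longrightarrow> P u v)" ..
  from assms(2)[unfolded around_def]
  obtain e' where e': "e' > 0 \<and> (\<forall>u v. u < t \<longrightarrow> t < v \<longrightarrow> v - u < e' \<longrightarrow> Q u v)" ..
  show ?thesis unfolding around_def
    by (intro exI[of _ "min e e'"] conjI allI impI) (use e e' in auto)
qed

text \<open>
  Slopes that neither oscillate nor tend to infinity have a limit \<open>D\<close>, the supremum of the numbers that eventually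
  bound them from below. By continuity, the estimate for intervals around \<open>t\<close> extends to those with \<open>t\<close> as an end
  point.
\<close>

lemma differentiable_if_slopes_settle:
  fixes F :: "real \<Rightarrow> real"
  assumes cont: "continuous (at t) F"
    and osc: "\<And>p q. p \<in> \<rat> \<Longrightarrow> q \<in> \<rat> \<Longrightarrow> p < q \<Longrightarrow>
      t \<notin> steep_points F q \<inter> steep_points (\<lambda>t. - F t) (- p)"
    and up: "t \<notin> (\<Inter>n::nat. steep_points F (real n))"
    and down: "t \<notin> (\<Inter>n::nat. steep_points (\<lambda>t. - F t) (real n))"
  shows "F differentiable (at t)"
proof -
  have upper: "around t (\<lambda>u v. F v - F u \<le> q * (v - u))" if "t \<notin> steep_points F q" for q
  proof (rule ccontr)
    assume no: "\<not> ?thesis"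
    have "\<exists>u v. u < t \<and> t < v \<and> v - u < e \<and> q * (v - u) < F v - F u" if "e > 0" for e
      using no that unfolding around_def not_ex not_all de_Morgan_conj not_imp not_le by blast
    with \<open>t \<notin> steep_points F q\<close> show False unfolding steep_points_def by blast
  qed
  have lower: "around t (\<lambda>u v. p * (v - u) \<le> F v - F u)" if "t \<notin> steep_points (\<lambda>t. - F t) (- p)" for p
  proof (rule ccontr)
    assume no: "\<not> ?thesis"
    have "\<exists>u v. u < t \<and> t < v \<and> v - u < e \<and> - p * (v - u) < - F v - - F u" if "e > 0" for e
    proof -
      from no that obtain u v where "u < t" "t < v" "v - u < e" "F v - F u < p * (v - u)"
        unfolding around_def not_ex not_all de_Morgan_conj not_imp not_le by blast
      then show ?thesis by (intro exI[of _ u] exI[of _ v]) simp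
    qed
    with \<open>t \<notin> steep_points (\<lambda>t. - F t) (- p)\<close> show False unfolding steep_points_def by blast
  qed
  define L where "L = {p. around t (\<lambda>u v. p * (v - u) \<le> F v - F u)}"
  obtain n :: nat where "t \<notin> steep_points (\<lambda>t. - F t) (- (- real n))" using down by auto
  from lower[OF this] have "- real n \<in> L" by (simp add: L_def)
  then have nonempty: "L \<noteq> {}" by auto
  obtain m :: nat where m: "t \<notin> steep_points F (real m)" using up by auto
  have bdd: "p \<le> real m" if "p \<in> L" for p
  proof -
    from that have "around t (\<lambda>u v. p * (v - u) \<le> F v - F u)" by (simp add: L_def)
    from around_conj[OF upper[OF m] this, unfolded around_def]
    obtain e where e: "e > 0 \<and> (\<forall>u v. u < t \<longrightarrow> t < v \<longrightarrow> v - u < e \<longrightarrow>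
        F v - F u \<le> real m * (v - u) \<and> p * (v - u) \<le> F v - F u)" ..
    define w where "w = (t + e / 3) - (t - e / 3)"
    have "F (t + e / 3) - F (t - e / 3) \<le> real m * w \<and> p * w \<le> F (t + e / 3) - F (t - e / 3)"
      unfolding w_def using e by (intro e[THEN conjunct2, rule_format]) auto
    then have "p * w \<le> real m * w" by linarith
    then show ?thesis by (rule mult_right_le_imp_le) (use e in \<open>simp add: w_def\<close>)
  qed
  then have bdd': "bdd_above L" by (auto simp: bdd_above_def)
  define D where "D = Sup L"
  have both: "around t (\<lambda>u v. \<bar>F v - F u - D * (v - u)\<bar> \<le> \<epsilon> * (v - u))" if eps: "\<epsilon> > 0" for \<epsilon>
  proof -
    obtain p where p: "p \<in> L" "D - \<epsilon> < p"
      using less_cSupD[OF nonempty, of "D - \<epsilon>"] eps D_def by auto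
    have lo: "around t (\<lambda>u v. (D - \<epsilon>) * (v - u) \<le> F v - F u)"
    proof (rule around_mono)
      show "around t (\<lambda>u v. p * (v - u) \<le> F v - F u)" using p by (simp add: L_def)
      show "(D - \<epsilon>) * (v - u) \<le> F v - F u" if "u < v" "p * (v - u) \<le> F v - F u" for u v
        using that p(2) mult_right_mono[of "D - \<epsilon>" p "v - u"] by linarith
    qed
    \<comment> \<open>If slopes above \<open>D + \<epsilon>\<close> kept occurring, slopes would oscillate around the rationals
      \<open>p' < q'\<close> in between, as \<open>p' > D\<close> does not bound them from below.\<close>
    obtain p' where p': "p' \<in> \<rat>" "D < p'" "p' < D + \<epsilon>"
      using Rats_dense_in_real[of D "D + \<epsilon>"] eps by auto
    obtain q' where q': "q' \<in> \<rat>" "p' < q'" "q' < D + \<epsilon>"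
      using Rats_dense_in_real[of p' "D + \<epsilon>"] p' by auto
    have "p' \<notin> L" using p'(2) cSup_upper[OF _ bdd'] unfolding D_def by force
    then have "t \<in> steep_points (\<lambda>t. - F t) (- p')" using lower[of p'] by (auto simp: L_def)
    then have "t \<notin> steep_points F q'" using osc[OF p'(1) q'(1,2)] by blast
    then have hi: "around t (\<lambda>u v. F v - F u \<le> (D + \<epsilon>) * (v - u))"
    proof (rule around_mono[OF upper])
      show "F v - F u \<le> (D + \<epsilon>) * (v - u)" if "u < v" "F v - F u \<le> q' * (v - u)" for u v
        using that q'(3) mult_right_mono[of q' "D + \<epsilon>" "v - u"] by linarith
    qed
    show ?thesis
      by (rule around_mono[OF around_conj[OF lo hi]]) (auto simp: abs_le_iff algebra_simps)
  qed
  have "(F has_real_derivative D) (at t)"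
    unfolding has_field_derivative_iff LIM_eq
  proof (intro allI impI)
    fix \<epsilon> :: real assume \<epsilon>: "\<epsilon> > 0"
    from both[OF half_gt_zero[OF \<epsilon>], unfolded around_def]
    obtain e where e_both: "e > 0 \<and> (\<forall>u v. u < t \<longrightarrow> t < v \<longrightarrow> v - u < e \<longrightarrow>
        \<bar>F v - F u - D * (v - u)\<bar> \<le> \<epsilon> / 2 * (v - u))" ..
    then have e: "e > 0" by simp
    note be = e_both[THEN conjunct2, rule_format]
    have right: "\<bar>F v - F t - D * (v - t)\<bar> \<le> \<epsilon> / 2 * (v - t)" if "t < v" "v - t < e" for v
    proof (rule tendsto_le[of "at_left t"])
      have "(F \<longlongrightarrow> F t) (at_left t)"
        using cont by (simp add: continuous_within filterlim_at_split)
      then show "((\<lambda>u. \<bar>F v - F u - D * (v - u)\<bar>) \<longlongrightarrow> \<bar>F v - F t - D * (v - t)\<bar>) (at_left t)"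
        "((\<lambda>u. \<epsilon> / 2 * (v - u)) \<longlongrightarrow> \<epsilon> / 2 * (v - t)) (at_left t)"
        by (auto intro!: tendsto_intros)
      have "eventually (\<lambda>u. u \<in> {v - e<..<t}) (at_left t)"
        using that by (intro eventually_at_leftI) auto
      then show "eventually (\<lambda>u. \<bar>F v - F u - D * (v - u)\<bar> \<le> \<epsilon> / 2 * (v - u)) (at_left t)"
        by eventually_elim (use be that in auto)
    qed simp
    have left: "\<bar>F t - F u - D * (t - u)\<bar> \<le> \<epsilon> / 2 * (t - u)" if "u < t" "t - u < e" for u
    proof (rule tendsto_le[of "at_right t"])
      have "(F \<longlongrightarrow> F t) (at_right t)"
        using cont by (simp add: continuous_within filterlim_at_split)
      then show "((\<lambda>v. \<bar>F v - F u - D * (v - u)\<bar>) \<longlongrightarrow> \<bar>F t - F u - D * (t - u)\<bar>) (at_right t)"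
        "((\<lambda>v. \<epsilon> / 2 * (v - u)) \<longlongrightarrow> \<epsilon> / 2 * (t - u)) (at_right t)"
        by (auto intro!: tendsto_intros)
      have "eventually (\<lambda>v. v \<in> {t<..<u + e}) (at_right t)"
        using that by (intro eventually_at_rightI) auto
      then show "eventually (\<lambda>v. \<bar>F v - F u - D * (v - u)\<bar> \<le> \<epsilon> / 2 * (v - u)) (at_right t)"
        by eventually_elim (use be that in auto)
    qed simp
    show "\<exists>s>0. \<forall>x. x \<noteq> t \<and> norm (x - t) < s \<longrightarrow> norm ((F x - F t) / (x - t) - D) < \<epsilon>"
    proof (intro exI conjI allI impI)
      fix x assume x: "x \<noteq> t \<and> norm (x - t) < e"
      have "\<bar>F x - F t - D * (x - t)\<bar> \<le> \<epsilon> / 2 * \<bar>x - t\<bar>"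
        using right[of x] left[of x] x by (cases "x > t") (auto simp: abs_if algebra_simps split: if_splits)
      moreover have "(F x - F t) / (x - t) - D = (F x - F t - D * (x - t)) / (x - t)"
        using x by (simp add: field_simps)
      ultimately have "norm ((F x - F t) / (x - t) - D) \<le> \<epsilon> / 2"
        using x by (simp add: abs_divide divide_le_eq)
      then show "norm ((F x - F t) / (x - t) - D) < \<epsilon>" using \<epsilon> by simp
    qed (rule e)
  qed
  then show ?thesis unfolding real_differentiable_def by blast
qed

lemma locally_abs_continuous_isCont:
  assumes "locally_abs_continuous F"
  shows "isCont F t"
  unfolding continuous_at_eps_delta
proof (intro allI impI)
  fix e :: real assume "e > 0"
  have "abs_continuous_on_interval (t - 1) (t + 1) F"
    using assms by (simp add: locally_abs_continuous_def)
  then obtain \<delta> where \<delta>: "\<delta> > 0" and ac: "\<And>n u v. \<lbrakk>\<forall>i<n. t - 1 \<le> u i \<and> u i \<le> v i \<and> v i \<le> t + 1;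
      disjoint_family_on (\<lambda>i. {u i<..<v i}) {..<n}; (\<Sum>i<n. v i - u i) < \<delta>\<rbrakk>
      \<Longrightarrow> (\<Sum>i<n::nat. \<bar>F (v i) - F (u i)\<bar>) < e"
    using abs_continuous_on_intervalE[OF _ \<open>e > 0\<close>] by blast
  have *: "\<bar>F v - F u\<bar> < e" if "t - 1 \<le> u" "u \<le> v" "v \<le> t + 1" "v - u < \<delta>" for u v
    using ac[of 1 "\<lambda>_. u" "\<lambda>_. v"] that by (simp add: disjoint_family_on_def)
  have "\<bar>F x - F t\<bar> < e" if "\<bar>x - t\<bar> < min 1 \<delta>" for x
    using *[of t x] *[of x t] that by (cases "t \<le> x") (auto simp: abs_minus_commute)
  then show "\<exists>d>0. \<forall>x. dist x t < d \<longrightarrow> dist (F x) (F t) < e"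
    using \<delta> by (intro exI[of _ "min 1 \<delta>"]) (auto simp: dist_real_def)
qed

lemma locally_abs_continuous_uminus:
  "locally_abs_continuous F \<Longrightarrow> locally_abs_continuous (\<lambda>t. - F t)"
  unfolding locally_abs_continuous_def abs_continuous_on_interval_def
  by (simp add: abs_minus_commute)

theorem locally_abs_continuous_AE_differentiable:
  assumes F: "locally_abs_continuous F"
  shows "AE t in lebesgue. F differentiable (at t)"
proof -
  let ?osc = "\<Union>(p, q)\<in>{(p, q). p \<in> \<rat> \<and> q \<in> \<rat> \<and> p < q}. steep_points F q \<inter> steep_points (\<lambda>t. - F t) (- p)"
  have "countable {(p, q::real). p \<in> \<rat> \<and> q \<in> \<rat> \<and> p < q}"
    by (rule countable_subset[of _ "\<rat> \<times> \<rat>"]) (auto intro: countable_SIGMA countable_rat)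
  then have "negligible ?osc"
    by (intro negligible_countable_Union countable_image)
       (auto intro: negligible_oscillating_slopes[OF F])
  then have "negligible (?osc \<union> ((\<Inter>n::nat. steep_points F (real n)) \<union> (\<Inter>n::nat. steep_points (\<lambda>t. - F t) (real n))))"
    by (intro negligible_Un negligible_infinite_slope F locally_abs_continuous_uminus)
  then show ?thesis
    unfolding negligible_iff_null_sets
  proof (rule AE_I', intro subsetI)
    fix t assume "t \<in> {t \<in> space lebesgue. \<not> F differentiable at t}"
    then show "t \<in> ?osc \<union> ((\<Inter>n::nat. steep_points F (real n)) \<union> (\<Inter>n::nat. steep_points (\<lambda>t. - F t) (real n)))"
      using differentiable_if_slopes_settle[OF locally_abs_continuous_isCont[OF F], of t] by blast
  qed
qed

text \<open>
  Almost every point of the interval has arbitrarily short intervals around it with slope below \<open>N + \<epsilon>\<close>.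
  Finitely many disjoint ones nearly fill \<open>[c, d]\<close>, and absolute continuity takes care of the rest.
\<close>

lemma locally_abs_continuous_growth:
  assumes F: "locally_abs_continuous F" and ae: "AE t in lebesgue. deriv F t \<le> N" and "c \<le> d"
  shows "F d - F c \<le> N * (d - c)"
proof (cases "c = d")
  case False
  then have "c < d" using \<open>c \<le> d\<close> by simp
  let ?m = "measure lebesgue"
  have "F d - F c \<le> N * (d - c) + \<epsilon> * (1 + (d - c) + \<bar>N\<bar>)" if \<epsilon>: "\<epsilon> > 0" for \<epsilon>
  proof -
    have "abs_continuous_on_interval c d F"
      using F \<open>c \<le> d\<close> by (simp add: locally_abs_continuous_def)
    then obtain \<delta> where \<delta>: "\<delta> > 0"
      "\<And>I J. I division_of \<Union>I \<Longrightarrow> \<Union>I \<subseteq> {c..d} \<Longrightarrow> J division_of \<Union>J \<Longrightarrow> \<Union>J \<subseteq> \<Union>I \<Longrightarrow>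
         ?m (\<Union>I) < ?m (\<Union>J) + \<delta> \<Longrightarrow>
         \<bar>(\<Sum>K\<in>I. increment F K) - (\<Sum>K\<in>J. increment F K)\<bar> < \<epsilon>"
      using abs_continuous_nested_divisions[OF _ \<epsilon> \<open>c \<le> d\<close>] by blast
    have "AE t in lebesgue. F differentiable (at t) \<and> deriv F t \<le> N"
      using locally_abs_continuous_AE_differentiable[OF F] ae by eventually_elim simp
    then obtain Z where Z: "Z \<in> null_sets lebesgue"
      "\<And>t. t \<notin> Z \<Longrightarrow> F differentiable (at t) \<and> deriv F t \<le> N"
      by (elim AE_E3) auto
    let ?E = "{c<..<d} - Z"
    have E: "?E \<in> lmeasurable" using Z(1) by (intro fmeasurable_Diff) auto
    have mE: "?m ?E = d - c"
      using Z(1) \<open>c < d\<close> by (subst measure_Diff_null_set) auto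
    obtain p where p: "p division_of \<Union>p" "\<Union>p \<subseteq> {c<..<d}"
      "\<And>K. K \<in> p \<Longrightarrow> \<exists>u v. u < v \<and> K = {u..v} \<and> - (N + \<epsilon>) * (v - u) < - F v - (- F u)"
      "?m (?E - \<Union>p) < min \<delta> \<epsilon>"
    proof (rule Vitali_division[OF E, where U = "{c<..<d}" and \<epsilon> = "min \<delta> \<epsilon>"
          and R = "\<lambda>u v. - (N + \<epsilon>) * (v - u) < - F v - (- F u)"])
      fix t e :: real assume "t \<in> ?E" "e > 0"
      then obtain D where D: "(F has_real_derivative D) (at t)" "D \<le> N"
        using Z(2) by (metis DERIV_deriv_iff_real_differentiable DiffD2)
      from D(1)[unfolded has_field_derivative_iff LIM_eq, rule_format, OF \<epsilon>]
      obtain s where "s > 0 \<and> (\<forall>x. x \<noteq> t \<and> norm (x - t) < s \<longrightarrow> norm ((F x - F t) / (x - t) - D) < \<epsilon>)" ..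
      then have s: "s > 0" "\<And>x. x \<noteq> t \<Longrightarrow> \<bar>x - t\<bar> < s \<Longrightarrow> \<bar>(F x - F t) / (x - t) - D\<bar> < \<epsilon>"
        by auto
      define h where "h = min s e / 3"
      have h: "0 < h" "h < s" "2 * h < e" using s(1) \<open>e > 0\<close> by (auto simp: h_def min_def)
      have "(F (t - h) - F t) / (t - h - t) = (F t - F (t - h)) / h"
        using h by (simp add: field_simps)
      then have "\<bar>(F (t + h) - F t) / h - D\<bar> < \<epsilon>" "\<bar>(F t - F (t - h)) / h - D\<bar> < \<epsilon>"
        using s(2)[of "t + h"] s(2)[of "t - h"] h by simp_all
      then have "(F (t + h) - F t) / h < N + \<epsilon>" "(F t - F (t - h)) / h < N + \<epsilon>"
        using D(2) by linarith+
      then have "F (t + h) - F t < (N + \<epsilon>) * h" "F t - F (t - h) < (N + \<epsilon>) * h"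
        using h by (simp_all add: divide_less_eq)
      then have "- (N + \<epsilon>) * ((t + h) - (t - h)) < - F (t + h) - (- F (t - h))"
        by (simp add: algebra_simps)
      then show "\<exists>u v. u < t \<and> t < v \<and> v - u < e \<and> - (N + \<epsilon>) * (v - u) < - F v - (- F u)"
        using h by (intro exI[of _ "t - h"] exI[of _ "t + h"]) auto
    qed (use \<delta> \<epsilon> in auto)
    have pm: "\<Union>p \<in> lmeasurable" using p(1) by (rule lmeasurable_division)
    have "?m ?E \<le> ?m (\<Union>p \<union> (?E - \<Union>p))"
      using E pm by (intro measure_mono_fmeasurable) (auto intro!: fmeasurable.Un fmeasurable.Diff)
    also have "\<dots> \<le> ?m (\<Union>p) + ?m (?E - \<Union>p)" using E pm by (intro measure_Un_le) auto
    finally have big: "d - c < ?m (\<Union>p) + min \<delta> \<epsilon>" using p(4) mE by linarith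
    have "?m (\<Union>p) \<le> ?m {c<..<d}" using p(2) pm by (intro measure_mono_fmeasurable) auto
    then have small: "?m (\<Union>p) \<le> d - c" using \<open>c < d\<close> by simp
    have I: "{{c..d}} division_of \<Union>{{c..d}}" using \<open>c \<le> d\<close> division_of_self[of c d] by simp
    have "\<bar>(\<Sum>K\<in>{{c..d}}. increment F K) - (\<Sum>K\<in>p. increment F K)\<bar> < \<epsilon>"
      using big p(2) \<open>c \<le> d\<close> by (intro \<delta>(2) I p(1)) fastforce+
    then have "F d - F c < (\<Sum>K\<in>p. increment F K) + \<epsilon>" using \<open>c \<le> d\<close> by (simp add: increment_interval)
    moreover have "- (N + \<epsilon>) * ?m (\<Union>p) \<le> - (\<Sum>K\<in>p. increment F K)"
      using steep_division_increment[where F = "\<lambda>t. - F t", OF p(1,3)]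
      by (simp add: increment_uminus sum_negf)
    moreover have "(N + \<epsilon>) * ?m (\<Union>p) \<le> N * (d - c) + \<bar>N\<bar> * \<epsilon> + \<epsilon> * (d - c)"
    proof -
      have "N * (?m (\<Union>p) - (d - c)) \<le> \<bar>N\<bar> * \<epsilon>"
        using big small by (intro order_trans[OF abs_ge_self, of "N * _"]) (auto simp: abs_mult intro!: mult_left_mono)
      moreover have "\<epsilon> * ?m (\<Union>p) \<le> \<epsilon> * (d - c)" using small \<epsilon> by (intro mult_left_mono) auto
      ultimately show ?thesis by (simp add: algebra_simps)
    qed
    ultimately show ?thesis by (simp add: algebra_simps)
  qed
  then have "F d - F c - N * (d - c) \<le> \<epsilon> * (1 + (d - c) + \<bar>N\<bar>)" if "\<epsilon> > 0" for \<epsilon>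
    using that by (simp add: diff_le_eq add.commute)
  moreover have "1 + (d - c) + \<bar>N\<bar> > 0"
    using \<open>c \<le> d\<close> by (simp add: add_pos_nonneg)
  ultimately have "F d - F c - N * (d - c) \<le> 0"
    by (rule nonpos_if_le_small_multiples)
  then show ?thesis by simp
qed simp

section \<open>Essential bounds on derivatives\<close>

text \<open>
  A continuous function that exceeds a value at a point does so on a nonempty open set, which is not null.
\<close>

lemma abs_le_Linf_norm:
  assumes "continuous_on UNIV f"
  shows "ereal \<bar>f t\<bar> \<le> Linf_norm f"
proof (rule ccontr)
  assume "\<not> ereal \<bar>f t\<bar> \<le> Linf_norm f"
  then have "t \<in> {s. Linf_norm f < ereal \<bar>f s\<bar>}" by simp
  moreover have "open {s. Linf_norm f < ereal \<bar>f s\<bar>}"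
    by (intro open_Collect_less continuous_intros assms)
  moreover have "AE s in lebesgue. ereal \<bar>f s\<bar> \<le> Linf_norm f"
    unfolding Linf_norm_def by (rule esssup_AE)
  then have "negligible {s. Linf_norm f < ereal \<bar>f s\<bar>}"
    by (simp add: negligible_iff_null_sets completion.AE_iff_null_sets not_le)
  ultimately show False
    using open_not_negligible by blast
qed

lemma Linf_norm_le:
  assumes "continuous_on UNIV f" "\<And>t. \<bar>f t\<bar> \<le> K"
  shows "Linf_norm f \<le> ereal K"
  unfolding Linf_norm_def
proof (rule esssup_I)
  have "f \<in> borel_measurable lebesgue"
    using borel_measurable_continuous_onI[OF assms(1)] by (simp add: measurable_completion)
  then show "(\<lambda>t. ereal \<bar>f t\<bar>) \<in> borel_measurable lebesgue" by measurable
qed (use assms(2) in auto)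

lemma lipschitz_imp_locally_abs_continuous:
  assumes lip: "\<And>s t. \<bar>F s - F t\<bar> \<le> N * \<bar>s - t\<bar>"
  shows "locally_abs_continuous F"
  unfolding locally_abs_continuous_def abs_continuous_on_interval_def
proof (intro allI impI)
  fix c d \<epsilon> :: real assume "\<epsilon> > 0"
  have "N \<ge> 0" using lip[of 1 0] by simp
  show "\<exists>\<delta>>0. \<forall>n u v. (\<forall>i<n. c \<le> u i \<and> u i \<le> v i \<and> v i \<le> d) \<longrightarrow>
      disjoint_family_on (\<lambda>i. {u i<..<v i}) {..<n} \<longrightarrow> (\<Sum>i<n. v i - u i) < \<delta> \<longrightarrow>
      (\<Sum>i<n::nat. \<bar>F (v i) - F (u i)\<bar>) < \<epsilon>"
  proof (intro exI conjI allI impI)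
    show "\<epsilon> / (N + 1) > 0" using \<open>\<epsilon> > 0\<close> \<open>N \<ge> 0\<close> by simp
    fix n and u v :: "nat \<Rightarrow> real"
    assume uv: "\<forall>i<n. c \<le> u i \<and> u i \<le> v i \<and> v i \<le> d"
      and small: "(\<Sum>i<n. v i - u i) < \<epsilon> / (N + 1)"
    have "(\<Sum>i<n. \<bar>F (v i) - F (u i)\<bar>) \<le> (\<Sum>i<n. N * (v i - u i))"
      using lip uv by (intro sum_mono) (metis abs_of_nonneg diff_ge_0_iff_ge lessThan_iff)
    also have "\<dots> = N * (\<Sum>i<n. v i - u i)" by (simp add: sum_distrib_left)
    also have "\<dots> \<le> N * (\<epsilon> / (N + 1))"
      using small \<open>N \<ge> 0\<close> by (intro mult_left_mono) auto
    also have "\<dots> < \<epsilon>" using \<open>\<epsilon> > 0\<close> \<open>N \<ge> 0\<close> by (simp add: field_simps)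
    finally show "(\<Sum>i<n. \<bar>F (v i) - F (u i)\<bar>) < \<epsilon>" .
  qed
qed

text \<open>
  Almost everywhere the derivative is a limit of difference quotients along the sequence \<open>1 / (n + 1)\<close>, and Lebesgue
  measurability ignores null sets.
\<close>

lemma borel_measurable_deriv:
  fixes F :: "real \<Rightarrow> real"
  assumes F: "continuous_on UNIV F" and diff: "AE t in lebesgue. F differentiable (at t)"
  shows "deriv F \<in> borel_measurable lebesgue"
proof (rule borel_measurable_AE)
  let ?q = "\<lambda>n t. (F (t + inverse (real (Suc n))) - F t) / inverse (real (Suc n))"
  have "?q n \<in> borel_measurable lebesgue" for n
  proof -
    have "continuous_on UNIV (?q n)"
      by (intro continuous_intros continuous_on_compose2[OF F]) auto
    then have "?q n \<in> borel_measurable borel"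
      by (rule borel_measurable_continuous_onI)
    then show ?thesis by (simp add: measurable_completion)
  qed
  then show "(\<lambda>t. lim (\<lambda>n. ?q n t)) \<in> borel_measurable lebesgue"
    by (rule borel_measurable_lim_metric)
  show "AE t in lebesgue. lim (\<lambda>n. ?q n t) = deriv F t"
    using diff
  proof eventually_elim
    case (elim t)
    then have "(F has_real_derivative deriv F t) (at t)"
      by (simp add: DERIV_deriv_iff_real_differentiable)
    then have "((\<lambda>h. (F (t + h) - F t) / h) \<longlongrightarrow> deriv F t) (at 0)"
      by (simp add: DERIV_def)
    moreover have "filterlim (\<lambda>n. inverse (real (Suc n))) (at 0) sequentially"
      using LIMSEQ_inverse_real_of_nat by (simp add: filterlim_at)
    ultimately have "(\<lambda>n. ?q n t) \<longlonglongrightarrow> deriv F t"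
      by (rule filterlim_compose)
    then show ?case by (rule limI)
  qed
qed

lemma Linf_norm_deriv_le_of_lipschitz:
  assumes lip: "\<And>s t. \<bar>F s - F t\<bar> \<le> N * \<bar>s - t\<bar>"
  shows "Linf_norm (deriv F) \<le> ereal N"
  unfolding Linf_norm_def
proof (rule esssup_I)
  have ac: "locally_abs_continuous F"
    by (rule lipschitz_imp_locally_abs_continuous[OF lip])
  have diff: "AE t in lebesgue. F differentiable (at t)"
    by (rule locally_abs_continuous_AE_differentiable[OF ac])
  have "continuous_on UNIV F"
    using locally_abs_continuous_isCont[OF ac] by (simp add: continuous_at_imp_continuous_on)
  then have [measurable]: "deriv F \<in> borel_measurable lebesgue"
    by (rule borel_measurable_deriv[OF _ diff])
  show "(\<lambda>t. ereal \<bar>deriv F t\<bar>) \<in> borel_measurable lebesgue" by measurable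
  show "AE t in lebesgue. ereal \<bar>deriv F t\<bar> \<le> ereal N"
    using diff
  proof eventually_elim
    case (elim t)
    then have "((\<lambda>h. (F (t + h) - F t) / h) \<longlongrightarrow> deriv F t) (at 0)"
      by (simp add: DERIV_deriv_iff_real_differentiable flip: DERIV_def)
    then have "((\<lambda>h. \<bar>(F (t + h) - F t) / h\<bar>) \<longlongrightarrow> \<bar>deriv F t\<bar>) (at 0)"
      by (rule tendsto_rabs)
    moreover have "\<bar>(F (t + h) - F t) / h\<bar> \<le> N" if "h \<noteq> 0" for h
      using lip[of "t + h" t] that by (simp add: abs_divide divide_le_eq)
    then have "eventually (\<lambda>h. \<bar>(F (t + h) - F t) / h\<bar> \<le> N) (at 0)"
      by (simp add: eventually_at_filter)
    ultimately have "\<bar>deriv F t\<bar> \<le> N"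
      by (rule tendsto_upperbound) simp
    then show ?case by simp
  qed
qed

text \<open>
  Applying \<open>locally_abs_continuous_growth\<close> to \<open>F\<close> and \<open>- F\<close> needs the derivative of \<open>- F\<close> to be \<open>- deriv F\<close> almost
  everywhere, which is not automatic, as \<open>deriv\<close> is unspecified where \<open>F\<close> has no derivative.
\<close>

lemma lipschitz_of_Linf_norm_deriv_le:
  assumes F: "locally_abs_continuous F" and le: "Linf_norm (deriv F) \<le> ereal N"
  shows "\<bar>F s - F t\<bar> \<le> N * \<bar>s - t\<bar>"
proof -
  have "AE t in lebesgue. ereal \<bar>deriv F t\<bar> \<le> Linf_norm (deriv F)"
    unfolding Linf_norm_def by (rule esssup_AE)
  then have ae: "AE t in lebesgue. \<bar>deriv F t\<bar> \<le> N"
    by eventually_elim (use le order_trans in fastforce)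
  have "AE t in lebesgue. deriv F t \<le> N"
    using ae by eventually_elim auto
  note up = locally_abs_continuous_growth[OF F this]
  have "AE t in lebesgue. deriv (\<lambda>t. - F t) t \<le> N"
    using ae locally_abs_continuous_AE_differentiable[OF F]
  proof eventually_elim
    case (elim t)
    then have "deriv (\<lambda>t. - F t) t = - deriv F t"
      by (intro DERIV_imp_deriv DERIV_minus) (simp add: DERIV_deriv_iff_real_differentiable)
    with elim show ?case by simp
  qed
  note down = locally_abs_continuous_growth[OF locally_abs_continuous_uminus[OF F] this]
  have "\<bar>F v - F u\<bar> \<le> N * (v - u)" if "u \<le> v" for u v
    using up[OF that] down[OF that] by (simp add: abs_le_iff)
  from this[of s t] this[of t s] show ?thesis
    by (cases "s \<le> t") (auto simp: abs_minus_commute)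
qed

section \<open>The inequality for intermediate derivatives\<close>

lemma higher_deriv_Psi:
  assumes "a \<ge> 0" "k \<le> m"
  shows "(deriv ^^ k) (Psi (Suc m) a b l) t = b * l ^ k * psi (Suc (m - k)) a (l * t)"
  using \<open>k \<le> m\<close>
proof (induction k arbitrary: t)
  case 0
  then show ?case by (simp add: Psi_def)
next
  case (Suc k)
  have "((\<lambda>t. psi (Suc (m - k)) a (l * t)) has_real_derivative
      l * psi (Suc (m - Suc k)) a (l * t)) (at t)"
    using DERIV_affine[of "psi (Suc (m - k)) a" "psi (Suc (m - Suc k)) a" 0 l t]
      psi_deriv[OF assms(1), of "m - Suc k"] Suc.prems by (simp add: Suc_diff_Suc)
  from DERIV_cmult[OF this, of "b * l ^ k"]
  have "((\<lambda>t. b * l ^ k * psi (Suc (m - k)) a (l * t)) has_real_derivative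
      b * l ^ k * (l * psi (Suc (m - Suc k)) a (l * t))) (at t)" .
  moreover have "(deriv ^^ k) (Psi (Suc m) a b l) = (\<lambda>t. b * l ^ k * psi (Suc (m - k)) a (l * t))"
    using Suc by (intro ext) simp
  ultimately have "((deriv ^^ k) (Psi (Suc m) a b l) has_real_derivative
      b * l ^ k * (l * psi (Suc (m - Suc k)) a (l * t))) (at t)" by simp
  then show ?case by (simp add: DERIV_imp_deriv mult_ac)
qed

lemma psi_eq_bump: "psi (Suc n) a t = bump a n (t - (real n - 2) * (a / 2 + 1))"
  by (simp add: bump_def)

lemma Linf_norm_higher_deriv_Psi:
  assumes "a \<ge> 0" "b > 0" "l > 0" "k \<le> m"
  shows "Linf_norm ((deriv ^^ k) (Psi (Suc m) a b l)) = ereal (b * l ^ k * bump a (m - k) 0)"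
proof (rule antisym)
  let ?D = "(deriv ^^ k) (Psi (Suc m) a b l)"
  have D: "?D = (\<lambda>t. b * l ^ k * psi (Suc (m - k)) a (l * t))"
    using higher_deriv_Psi[OF assms(1,4)] by blast
  have cont: "continuous_on UNIV ?D"
    unfolding D by (intro continuous_intros continuous_on_compose2[OF psi_continuous[OF assms(1)]]) auto
  have pos: "b * l ^ k > 0" using assms by simp
  show "Linf_norm ?D \<le> ereal (b * l ^ k * bump a (m - k) 0)"
  proof (rule Linf_norm_le[OF cont])
    fix t
    show "\<bar>?D t\<bar> \<le> b * l ^ k * bump a (m - k) 0"
      unfolding D psi_eq_bump abs_mult[of "b * l ^ k"] abs_of_pos[OF pos]
      by (rule mult_left_mono[OF bump_le_peak[OF assms(1)] less_imp_le[OF pos]])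
  qed
  \<comment> \<open>The peak of the bump, moved back by the shift in \<open>bump\<close>.\<close>
  let ?t = "(real (m - k) - 2) * (a / 2 + 1) / l"
  have "?D ?t = b * l ^ k * bump a (m - k) 0"
    unfolding D psi_eq_bump using assms(3) by simp
  moreover have "bump a (m - k) 0 > 0" by (rule bump_peak_pos[OF assms(1)])
  ultimately show "ereal (b * l ^ k * bump a (m - k) 0) \<le> Linf_norm ?D"
    using abs_le_Linf_norm[OF cont, of ?t] pos by simp
qed

text \<open>
  The derivative of order \<open>m\<close> is a scaled \<open>psi1\<close>, which is piecewise linear. Its own derivative exists only
  almost everywhere and is bounded by the Lipschitz constant.
\<close>

lemma Linf_norm_top_deriv_Psi:
  assumes "a \<ge> 0" "b > 0" "l > 0"
  shows "Linf_norm ((deriv ^^ Suc m) (Psi (Suc m) a b l)) \<le> ereal (b * l ^ Suc m)"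
proof -
  have D: "(deriv ^^ m) (Psi (Suc m) a b l) = (\<lambda>t. b * l ^ m * psi1 a (l * t))"
    using higher_deriv_Psi[OF assms(1) order_refl, of m] by (auto simp: psi_def)
  have "\<bar>b * l ^ m * psi1 a (l * s) - b * l ^ m * psi1 a (l * t)\<bar> \<le> b * l ^ Suc m * \<bar>s - t\<bar>" for s t
  proof -
    have "\<bar>b * l ^ m * psi1 a (l * s) - b * l ^ m * psi1 a (l * t)\<bar>
        = b * l ^ m * \<bar>psi1 a (l * s) - psi1 a (l * t)\<bar>"
      using assms by (simp add: abs_mult flip: right_diff_distrib)
    also have "\<dots> \<le> b * l ^ m * \<bar>l * s - l * t\<bar>"
      using assms by (intro mult_left_mono psi1_lipschitz) auto
    also have "\<bar>l * s - l * t\<bar> = l * \<bar>s - t\<bar>"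
      using assms by (simp add: abs_mult flip: right_diff_distrib)
    finally show ?thesis by (simp add: mult_ac)
  qed
  then show ?thesis
    using Linf_norm_deriv_le_of_lipschitz[of "(deriv ^^ m) (Psi (Suc m) a b l)"] by (simp add: D)
qed

theorem theorem3:
  fixes r k2 :: nat and x :: "real \<Rightarrow> real" and a b l :: real
  assumes "r \<ge> 1"
    and "0 < k2" and "k2 < r - 2"
    and "x \<in> Lr_inf_inf r"
    and "a > 0" and "b > 0" and "l > 0"
    and "\<forall>s \<in> {0, r - 2, r}.
           Linf_norm ((deriv ^^ s) x) \<le> Linf_norm ((deriv ^^ s) (Psi r a b l))"
  shows "Linf_norm ((deriv ^^ k2) x) \<le> Linf_norm ((deriv ^^ k2) (Psi r a b l))"
proof -
  define m where "m = r - 1"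
  have r: "r = Suc m" and k2: "k2 < m" "1 < m" "r - 2 = m - 1"
    using assms(1-3) by (auto simp: m_def)
  have a: "a \<ge> 0" and bl: "b * l ^ k > 0" for k using assms by auto
  have diff: "((deriv ^^ k) x has_real_derivative (deriv ^^ Suc k) x t) (at t)" if "k < m" for k t
    using assms(4) that unfolding Lr_inf_inf_def Lr_inf_def r
    by (simp add: DERIV_deriv_iff_real_differentiable)
  have cont: "continuous_on UNIV ((deriv ^^ k) x)" if "k < m" for k
    using diff[OF that] DERIV_isCont by (intro continuous_at_imp_continuous_on) blast
  have bound: "\<bar>(deriv ^^ k) x t\<bar> \<le> b * l ^ k * bump a (m - k) 0" if "k \<in> {0, m - 1}" for k t
  proof -
    have "ereal \<bar>(deriv ^^ k) x t\<bar> \<le> Linf_norm ((deriv ^^ k) x)"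
      using that k2 by (intro abs_le_Linf_norm cont) auto
    also have "\<dots> \<le> Linf_norm ((deriv ^^ k) (Psi r a b l))"
      using assms(8) that k2(3) by auto
    also have "\<dots> = ereal (b * l ^ k * bump a (m - k) 0)"
      unfolding r using that by (intro Linf_norm_higher_deriv_Psi a assms) auto
    finally show ?thesis by simp
  qed
  have lip: "\<bar>(deriv ^^ m) x s - (deriv ^^ m) x t\<bar> \<le> b * l ^ Suc m * \<bar>s - t\<bar>" for s t
  proof (rule lipschitz_of_Linf_norm_deriv_le)
    show "locally_abs_continuous ((deriv ^^ m) x)"
      using assms(4) by (simp add: Lr_inf_inf_def Lr_inf_def r)
    have "Linf_norm ((deriv ^^ r) x) \<le> Linf_norm ((deriv ^^ r) (Psi r a b l))"
      using assms(8) by blast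
    also have "\<dots> \<le> ereal (b * l ^ Suc m)"
      unfolding r by (intro Linf_norm_top_deriv_Psi a assms)
    finally show "Linf_norm (deriv ((deriv ^^ m) x)) \<le> ereal (b * l ^ Suc m)"
      by (simp add: r)
  qed
  \<comment> \<open>Time is scaled by \<open>l\<close> and values by those of \<open>Psi\<close>, so that the comparison splines become the bumps.\<close>
  define G where "G j t = (deriv ^^ (m - j)) x (t / l) / (b * l ^ (m - j))" for j t
  have G_le: "\<bar>G j t\<bar> \<le> bump a j 0" if "m - j \<in> {0, m - 1}" "j \<le> m" for j t
    using bound[OF that(1), of "t / l"] that(2)
    unfolding G_def abs_divide abs_of_pos[OF bl] pos_divide_le_eq[OF bl] by (simp add: mult.commute)
  have "spline_class a 1 m G"
    unfolding spline_class_def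
  proof (intro conjI allI impI)
    fix j t assume "j < m"
    then have mj: "m - Suc j < m" "m - j = Suc (m - Suc j)" by auto
    have "((\<lambda>t. (deriv ^^ (m - Suc j)) x (t / l)) has_real_derivative
        1 / l * (deriv ^^ (m - j)) x (t / l)) (at t)"
      using DERIV_affine[OF diff[OF mj(1)], of 0 "1 / l" t] by (simp add: mj(2))
    from DERIV_cdivide[OF this, of "b * l ^ (m - Suc j)"]
    show "(G (Suc j) has_real_derivative G j t) (at t)"
      unfolding G_def using mj(2) by (simp add: mult_ac)
  next
    fix s t
    have "\<bar>G 0 s - G 0 t\<bar> = \<bar>(deriv ^^ m) x (s / l) - (deriv ^^ m) x (t / l)\<bar> / (b * l ^ m)"
      unfolding G_def diff_divide_distrib[symmetric] abs_divide abs_of_pos[OF bl] by simp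
    also have "\<dots> \<le> b * l ^ Suc m * \<bar>s / l - t / l\<bar> / (b * l ^ m)"
      using bl[of m] lip by (intro divide_right_mono) auto
    also have "\<bar>s / l - t / l\<bar> = \<bar>s - t\<bar> / l"
      using \<open>l > 0\<close> by (simp add: abs_divide flip: diff_divide_distrib)
    also have "b * l ^ Suc m * (\<bar>s - t\<bar> / l) / (b * l ^ m) = \<bar>s - t\<bar>"
      using \<open>l > 0\<close> \<open>b > 0\<close> by simp
    finally show "\<bar>G 0 s - G 0 t\<bar> \<le> 1 * \<bar>s - t\<bar>" by simp
  next
    fix t show "\<bar>G 1 t\<bar> \<le> 1 * bump a 1 0" using G_le[of 1 t] k2 by simp
  next
    fix t show "\<bar>G m t\<bar> \<le> 1 * bump a m 0" using G_le[of m t] by simp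
  qed
  then have "spline_class a 1 (m - k2) G"
    by (rule spline_class_mono[OF a]) simp
  then have G: "\<bar>G (m - k2) t\<bar> \<le> bump a (m - k2) 0" for t
    by (simp add: spline_class_def)
  have "Linf_norm ((deriv ^^ k2) x) \<le> ereal (b * l ^ k2 * bump a (m - k2) 0)"
  proof (rule Linf_norm_le[OF cont[OF k2(1)]])
    fix t
    show "\<bar>(deriv ^^ k2) x t\<bar> \<le> b * l ^ k2 * bump a (m - k2) 0"
      using G[of "l * t"] k2(1) \<open>l > 0\<close>
      unfolding G_def abs_divide abs_of_pos[OF bl] pos_divide_le_eq[OF bl] by (simp add: mult.commute)
  qed
  also have "\<dots> = Linf_norm ((deriv ^^ k2) (Psi r a b l))"
    unfolding r using k2 by (intro Linf_norm_higher_deriv_Psi[symmetric] a assms) auto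
  finally show ?thesis .
qed

end
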